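(* Let $\Gamma$ be a $\vartheta$-bounded configuration on $\mathbb{R}^d$ and $\alpha\in(0,2)$. Let $\omega:\mathbb{Z}^d\times\mathbb{Z}^d\to[0,\infty]$ be a function satisfying $\omega(x,y)=\omega(y,x)$ and $$\Lambda^{-1}\big(\mathbf 1_{V^\Gamma[x]}(y)+\mathbf 1_{V^\Gamma[y]}(x)\big)|x-y|^{-d-\alpha}\le\omega(x,y)\le\Lambda|x-y|^{-d-\alpha}$$ for $|x-y|>R_0$, where $R_0>0$, $\Lambda\ge 1$ are some constants. There exist constants $\kappa\ge1$, $c\ge 1$ such that for every $R>0$, $x_0\in\mathbb{R}^d$ and every function $f:B_{\kappa R}(x_0)\cap\mathbb{Z}^d\to\mathbb{R}$, $$\sum_{\substack{x,y\in B_R(x_0)\cap\mathbb{Z}^d\\|x-y|>R_0}}(f(x)-f(y))^2|x-y|^{-d-\alpha}\le c\sum_{\substack{x,y\in B_{\kappa R}(x_0)\cap\mathbb{Z}^d\\|x-y|>R_0}}(f(x)-f(y))^2\omega(x,y).$$ The constant $c$ depends on $\Lambda,\vartheta,R_0$ and on the dimension $d$. It does not depend on $\omega$ and $\Gamma$.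
   Context: For $v\in\mathbb{S}^{d-1}$ and $\vartheta\in(0,\frac{\pi}{2}]$ the cone with symmetry axis $v$ and apex angle $\vartheta$ is $\widetilde V(v,\vartheta)=\{h\in\mathbb{R}^d : h\neq 0,\ \langle v,h\rangle/|h|>\cos\vartheta\}$ and the double cone is $V(v,\vartheta)=\widetilde V(v,\vartheta)\cup(-\widetilde V(v,\vartheta))$. Let $\mathcal V$ be the set of all double cones. A configuration is a map $\Gamma:\mathbb{R}^d\to\mathcal V$. It is called $\vartheta$-bounded if the infimum $\vartheta$ of the apex angles of the double cones in $\Gamma(\mathbb{R}^d)$ is positive. Put $V^\Gamma[x]=x+\Gamma(x)$. $|\cdot|$ is the Euclidean norm and $B_R(x_0)$ the Euclidean ball. *)

theory Defs
  imports "HOL-Analysis.Analysis"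
begin

definition cone_of :: "real ^ 'd \<Rightarrow> real \<Rightarrow> (real ^ 'd) set" where
  "cone_of v \<theta> = {h. h \<noteq> 0 \<and> (v \<bullet> h) / norm h > cos \<theta>}"

definition double_cone :: "real ^ 'd \<Rightarrow> real \<Rightarrow> (real ^ 'd) set" where
  "double_cone v \<theta> = cone_of v \<theta> \<union> uminus ` cone_of v \<theta>"

definition double_cone_with_angle :: "real \<Rightarrow> (real ^ 'd) set \<Rightarrow> bool" where
  "double_cone_with_angle \<theta> C \<longleftrightarrow>
     0 < \<theta> \<and> \<theta> \<le> pi / 2 \<and> (\<exists>v. norm v = 1 \<and> C = double_cone v \<theta>)"

text \<open>
  A configuration is a map into the set of all double cones. In dimension at least 2 a double cone
  determines its apex angle, so the family \<open>a\<close> below is the family of the apex angles of \<open>\<Gamma>\<close>.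
  In dimension 1 the only double cone is the punctured line, which arises from every angle, and
  \<open>a\<close> is an arbitrary choice of angles under which the cones are regarded.
\<close>

definition bounded_configuration :: "real \<Rightarrow> (real ^ 'd \<Rightarrow> (real ^ 'd) set) \<Rightarrow> bool" where
  "bounded_configuration \<theta> \<Gamma> \<longleftrightarrow>
     (\<exists>a. (\<forall>x. double_cone_with_angle (a x) (\<Gamma> x)) \<and> \<theta> = (INF x. a x) \<and> 0 < \<theta>)"

definition cone_at :: "(real ^ 'd \<Rightarrow> (real ^ 'd) set) \<Rightarrow> real ^ 'd \<Rightarrow> (real ^ 'd) set" where
  "cone_at \<Gamma> x = (\<lambda>h. x + h) ` \<Gamma> x"

definition int_lattice :: "(real ^ 'd) set" where
  "int_lattice = {x. \<forall>i. x $ i \<in> \<int>}"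

definition lattice_pairs :: "real \<Rightarrow> real ^ 'd \<Rightarrow> real \<Rightarrow> ((real ^ 'd) \<times> (real ^ 'd)) set" where
  "lattice_pairs R0 x0 R =
     {(x, y). x \<in> ball x0 R \<inter> int_lattice \<and> y \<in> ball x0 R \<inter> int_lattice \<and> norm (x - y) > R0}"

text \<open>Sums over these pairs are thus genuine finite sums.\<close>

lemma finite_lattice_pairs: "finite (lattice_pairs R0 x0 R)"
proof -
  obtain B where B: "\<And>x. x \<in> ball x0 R \<Longrightarrow> norm x \<le> B"
    using bounded_ball[of x0 R] unfolding bounded_iff by blast
  let ?E = "\<lambda>g :: 'a \<Rightarrow> int. (\<chi> i. real_of_int (g i)) :: real ^ 'a"
  have "ball x0 R \<inter> int_lattice \<subseteq> ?E ` (UNIV \<rightarrow>\<^sub>E {- \<lceil>B\<rceil>..\<lceil>B\<rceil>})"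
  proof
    fix x assume x: "x \<in> ball x0 R \<inter> int_lattice"
    define g where "g i = \<lfloor>x $ i\<rfloor>" for i
    have eq: "real_of_int (g i) = x $ i" for i
      using x by (auto simp: g_def int_lattice_def)
    have "\<bar>x $ i\<bar> \<le> B" for i
      using component_le_norm_cart[of x i] B[of x] x by auto
    then have "g i \<in> {- \<lceil>B\<rceil>..\<lceil>B\<rceil>}" for i
      using eq[of i] by (smt (verit) atLeastAtMost_iff ceiling_of_int ceiling_mono of_int_minus)
    then show "x \<in> ?E ` (UNIV \<rightarrow>\<^sub>E {- \<lceil>B\<rceil>..\<lceil>B\<rceil>})"
      by (intro image_eqI[of _ _ g]) (auto simp: vec_eq_iff eq)
  qed
  then have "finite (ball x0 R \<inter> int_lattice)"
    by (rule finite_subset) (auto intro!: finite_imageI finite_PiE)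
  then have "finite ((ball x0 R \<inter> int_lattice) \<times> (ball x0 R \<inter> int_lattice))"
    by (intro finite_cartesian_product)
  then show ?thesis
    by (rule finite_subset[rotated]) (auto simp: lattice_pairs_def)
qed

end

theory Submission
  imports Defs
begin

text \<open>
  Fix a scale \<open>r\<close>. The cone at a point \<open>x\<close> contains a ball of radius \<open>\<epsilon> r\<close>, all of whose lattice points
  are linked to \<open>x\<close>. If a ball has radius \<open>\<sigma>\<close>, then the double cone at any point at distance less than
  \<open>\<delta> \<sigma>\<close> from it, whatever its axis, meets it in a ball of radius comparable to \<open>\<sigma>\<close>; hence a bound for the
  sum of \<open>(f x - f y)\<^sup>2\<close> over a ball of points \<open>y\<close> passes to the concentric ball that is larger by the
  factor \<open>1 + \<delta>\<close>, at the cost of an average over links of length about \<open>r\<close>. Boundedly many such steps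
  reach all points within distance \<open>r\<close> of \<open>x\<close>. Summing over \<open>x\<close> gives the comparison at a single
  scale, with constants independent of \<open>r\<close>. The dyadic scales are then added up with weights
  \<open>r powr (- d - \<alpha>)\<close>: each link occurs only at scales at least comparable to its length, so its weights form a
  geometric series, whose ratio is at most \<open>1 / 2\<close> uniformly in \<open>\<alpha>\<close>.
\<close>

section \<open>Counting lattice points in balls\<close>

lemma finite_lattice_ball: "finite (ball p R \<inter> int_lattice)"
proof -
  \<comment> \<open>The threshold -1 admits the diagonal pairs, whose difference has norm 0.\<close>
  have "(\<lambda>x. (x, x)) ` (ball p R \<inter> int_lattice) \<subseteq> lattice_pairs (-1) p R"
    by (auto simp: lattice_pairs_def)
  then have "finite ((\<lambda>x. (x, x)) ` (ball p R \<inter> int_lattice))"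
    using finite_lattice_pairs by (rule finite_subset)
  then show ?thesis by (rule finite_imageD) (auto intro: inj_onI)
qed


text \<open>Integer vectors in a box correspond to independent choices from the coordinate
  intervals, so the count is a product; \<open>nat\<close> lets an empty interval count as
  zero.\<close>

lemma card_lattice_box:
  fixes a b :: "'d::finite \<Rightarrow> int"
  defines "X \<equiv> {x :: real ^ 'd. x \<in> int_lattice \<and> (\<forall>i. of_int (a i) \<le> x $ i \<and> x $ i \<le> of_int (b i))}"
  shows "finite X" and "card X = (\<Prod>i\<in>UNIV. nat (b i - a i + 1))"
proof -
  let ?E = "\<lambda>g :: 'd \<Rightarrow> int. (\<chi> i. real_of_int (g i)) :: real ^ 'd"
  have bij: "bij_betw ?E (PiE UNIV (\<lambda>i. {a i..b i})) X"
  proof (rule bij_betw_imageI)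
    show "inj_on ?E (PiE UNIV (\<lambda>i. {a i..b i}))"
      by (rule inj_onI) (auto simp: vec_eq_iff)
    show "?E ` PiE UNIV (\<lambda>i. {a i..b i}) = X"
    proof (rule antisym; rule subsetI)
      fix x assume x: "x \<in> X"
      define g where "g i = \<lfloor>x $ i\<rfloor>" for i
      have g: "real_of_int (g i) = x $ i" for i
        using x by (auto simp: g_def X_def int_lattice_def elim!: Ints_cases)
      have "a i \<le> g i \<and> g i \<le> b i" for i
        using x unfolding of_int_le_iff[where ?'a = real, symmetric] g by (simp add: X_def)
      then show "x \<in> ?E ` PiE UNIV (\<lambda>i. {a i..b i})"
        by (intro image_eqI[of _ _ g]) (auto simp: vec_eq_iff g PiE_UNIV_domain)
    qed (auto simp: X_def int_lattice_def PiE_iff)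
  qed
  show "finite X"
    using bij_betw_finite[OF bij] finite_PiE[of UNIV "\<lambda>i. {a i..b i}"] by simp
  show "card X = (\<Prod>i\<in>UNIV. nat (b i - a i + 1))"
    using bij_betw_same_card[OF bij] by (simp add: card_PiE)
qed

text \<open>The ball lies in a cube of side \<open>2 * \<sigma>\<close>, where each coordinate takes
  at most \<open>2 * \<sigma> + 1\<close> integer values, and this is at most
  \<open>3 * \<sigma>\<close> for \<open>\<sigma> \<ge> 1\<close>.\<close>

lemma card_lattice_ball_le:
  fixes p :: "real ^ 'd"
  assumes "\<sigma> \<ge> 1"
  shows "real (card (ball p \<sigma> \<inter> int_lattice)) \<le> (3 * \<sigma>) ^ CARD('d)"
proof -
  let ?a = "\<lambda>i. \<lceil>p $ i - \<sigma>\<rceil>" and ?b = "\<lambda>i. \<lfloor>p $ i + \<sigma>\<rfloor>"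
  let ?X = "{x :: real ^ 'd. x \<in> int_lattice \<and> (\<forall>i. of_int (?a i) \<le> x $ i \<and> x $ i \<le> of_int (?b i))}"
  have "ball p \<sigma> \<inter> int_lattice \<subseteq> ?X"
  proof
    fix x assume x: "x \<in> ball p \<sigma> \<inter> int_lattice"
    have "of_int (?a i) \<le> x $ i \<and> x $ i \<le> of_int (?b i)" for i
    proof -
      have "\<bar>(p - x) $ i\<bar> \<le> \<sigma>"
        using component_le_norm_cart[of "p - x" i] x by (simp add: dist_norm)
      moreover obtain k where "x $ i = of_int k"
        using x by (auto simp: int_lattice_def elim: Ints_cases)
      ultimately show ?thesis
        by (auto simp: ceiling_le_iff le_floor_iff)
    qed
    then show "x \<in> ?X" using x by auto
  qed
  then have "card (ball p \<sigma> \<inter> int_lattice) \<le> card ?X"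
    by (intro card_mono card_lattice_box)
  then have "real (card (ball p \<sigma> \<inter> int_lattice)) \<le> real (card ?X)"
    by (rule of_nat_mono)
  also have "real (card ?X) = (\<Prod>i\<in>UNIV. real (nat (?b i - ?a i + 1)))"
    unfolding card_lattice_box(2) by (rule of_nat_prod)
  also have "\<dots> \<le> (\<Prod>i\<in>(UNIV::'d set). 3 * \<sigma>)"
  proof (intro prod_mono conjI)
    fix i :: 'd
    have "of_int (?b i - ?a i + 1) \<le> 3 * \<sigma>"
      using assms by (simp; linarith)
    then show "real (nat (?b i - ?a i + 1)) \<le> 3 * \<sigma>"
      using assms by (cases "0 \<le> ?b i - ?a i + 1") auto
  qed simp
  finally show ?thesis by simp
qed

text \<open>The ball contains the cube of half-side
  \<open>\<tau> = \<sigma> / (2 * real CARD('d))\<close>, whose points are at l1-distance at most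
  \<open>\<sigma> / 2\<close> from \<open>p\<close>. Each coordinate interval contains at least
  \<open>2 * \<tau> - 1\<close> integers, hence at least \<open>\<tau>\<close>, since the assumption
  on \<open>\<sigma>\<close> says \<open>\<tau> \<ge> 1\<close>.\<close>

lemma card_lattice_ball_ge:
  fixes p :: "real ^ 'd"
  assumes "\<sigma> \<ge> 2 * real CARD('d)"
  shows "(\<sigma> / (2 * real CARD('d))) ^ CARD('d) \<le> real (card (ball p \<sigma> \<inter> int_lattice))"
proof -
  define \<tau> where "\<tau> = \<sigma> / (2 * real CARD('d))"
  have "0 < 2 * real CARD('d)" by simp
  then have \<sigma>: "0 < \<sigma>" by (rule less_le_trans[OF _ assms])
  have "real CARD('d) * \<tau> = \<sigma> / 2" by (simp add: \<tau>_def)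
  then have \<tau>: "\<tau> \<ge> 1" "real CARD('d) * \<tau> < \<sigma>"
    using assms \<sigma> by (simp add: \<tau>_def, linarith)
  let ?a = "\<lambda>i. \<lceil>p $ i - \<tau>\<rceil>" and ?b = "\<lambda>i. \<lfloor>p $ i + \<tau>\<rfloor>"
  let ?X = "{x :: real ^ 'd. x \<in> int_lattice \<and> (\<forall>i. of_int (?a i) \<le> x $ i \<and> x $ i \<le> of_int (?b i))}"
  have "?X \<subseteq> ball p \<sigma> \<inter> int_lattice"
  proof
    fix x assume x: "x \<in> ?X"
    have "\<bar>(p - x) $ i\<bar> \<le> \<tau>" for i
    proof -
      have "of_int (?a i) \<le> x $ i" "x $ i \<le> of_int (?b i)"
        using x by auto
      then have "p $ i - \<tau> \<le> x $ i" "x $ i \<le> p $ i + \<tau>"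
        by linarith+
      then show ?thesis by (simp add: abs_le_iff)
    qed
    then have "(\<Sum>i\<in>UNIV. \<bar>(p - x) $ i\<bar>) \<le> (\<Sum>i\<in>(UNIV::'d set). \<tau>)"
      by (intro sum_mono)
    then have "norm (p - x) < \<sigma>"
      using norm_le_l1_cart[of "p - x"] \<tau> by simp
    then show "x \<in> ball p \<sigma> \<inter> int_lattice" using x by (auto simp: dist_norm)
  qed
  then have "card ?X \<le> card (ball p \<sigma> \<inter> int_lattice)"
    by (intro card_mono finite_lattice_ball)
  then have "real (card ?X) \<le> real (card (ball p \<sigma> \<inter> int_lattice))"
    by (rule of_nat_mono)
  moreover have "real (card ?X) = (\<Prod>i\<in>UNIV. real (nat (?b i - ?a i + 1)))"
    unfolding card_lattice_box(2) by (rule of_nat_prod)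
  moreover have "(\<Prod>i\<in>(UNIV::'d set). \<tau>) \<le> (\<Prod>i\<in>UNIV. real (nat (?b i - ?a i + 1)))"
  proof (intro prod_mono conjI)
    fix i :: 'd
    have "\<tau> \<le> of_int (?b i - ?a i + 1)"
      using \<tau> by (simp; linarith)
    then show "\<tau> \<le> real (nat (?b i - ?a i + 1))"
      by linarith
  qed (use \<tau> in simp)
  ultimately show ?thesis by (simp add: \<tau>_def)
qed

section \<open>Balls inside double cones\<close>

text \<open>From here on the cones enter only through this property. It hides the axis and the
  angle, so a single \<open>\<epsilon>\<close> serves a whole configuration.\<close>

definition contains_cone :: "real \<Rightarrow> (real ^ 'd) set \<Rightarrow> bool" where
  "contains_cone \<epsilon> V \<longleftrightarrow> (\<exists>v. norm v = 1 \<and>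
     (\<forall>t>0. \<forall>h. norm (h - t *\<^sub>R v) < \<epsilon> * t \<longrightarrow> h \<in> V \<and> - h \<in> V))"

text \<open>With \<open>4 * \<epsilon> = 1 - cos \<theta>\<close>, points \<open>h\<close> of the
  ball satisfy \<open>v \<bullet> h > (1 - \<epsilon>) * t\<close> and
  \<open>norm h < (1 + \<epsilon>) * t\<close>, while
  \<open>cos \<theta> * (1 + \<epsilon>) \<le> 1 - \<epsilon>\<close>. The cone has its own angle
  \<open>a\<close>, so that the radius can be governed by a lower bound \<open>\<theta>\<close> for
  many angles.\<close>

lemma ball_subset_cone_of:
  assumes "norm v = 1" "t > 0" "0 \<le> cos \<theta>" "cos \<theta> < 1" "cos a \<le> cos \<theta>"
    and h: "norm (h - t *\<^sub>R v) < (1 - cos \<theta>) / 4 * t"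
  shows "h \<in> cone_of v a"
proof -
  define \<epsilon> where "\<epsilon> = (1 - cos \<theta>) / 4"
  have \<epsilon>: "0 < \<epsilon>" "\<epsilon> \<le> 1 / 4" using assms by (auto simp: \<epsilon>_def)
  have d: "norm (h - t *\<^sub>R v) < \<epsilon> * t" using h by (simp add: \<epsilon>_def)
  have nv: "norm (t *\<^sub>R v) = t" using assms by simp
  have up: "norm h < (1 + \<epsilon>) * t"
    using norm_triangle_sub[of h "t *\<^sub>R v"] d nv by (simp add: algebra_simps)
  have "\<bar>v \<bullet> (h - t *\<^sub>R v)\<bar> < \<epsilon> * t"
    using Cauchy_Schwarz_ineq2[of v "h - t *\<^sub>R v"] d assms by simp
  moreover have "v \<bullet> (h - t *\<^sub>R v) = v \<bullet> h - t"
    using assms by (simp add: inner_diff_right norm_eq_1)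
  ultimately have lo: "(1 - \<epsilon>) * t < v \<bullet> h" by (simp add: left_diff_distrib)
  have "\<epsilon> * t \<le> 1 / 4 * t" using \<epsilon> assms by (intro mult_right_mono) auto
  then have hn: "h \<noteq> 0" using lo assms by (auto simp: algebra_simps)
  have "cos a * norm h \<le> cos \<theta> * norm h"
    using assms by (intro mult_right_mono) auto
  also have "\<dots> \<le> cos \<theta> * ((1 + \<epsilon>) * t)"
    using assms up by (intro mult_left_mono) auto
  also have "\<dots> = (cos \<theta> * (1 + \<epsilon>)) * t" by simp
  also have "\<dots> \<le> (1 - \<epsilon>) * t"
  proof (intro mult_right_mono)
    have "\<epsilon> * (1 + cos \<theta>) \<le> \<epsilon> * 2" using assms \<epsilon> by (intro mult_left_mono) auto
    then show "cos \<theta> * (1 + \<epsilon>) \<le> 1 - \<epsilon>"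
      using \<epsilon> unfolding \<epsilon>_def by (simp add: field_simps)
  qed (use assms in simp)
  also note lo
  finally have "cos a < v \<bullet> h / norm h"
    using hn by (simp add: field_simps)
  then show ?thesis using hn by (simp add: cone_of_def)
qed

text \<open>The infimum \<open>\<theta>\<close> is a lower bound for every apex angle, and cosine
  decreases on \<open>[0, pi]\<close>, so the radius computed from \<open>\<theta>\<close> works at
  all points at once.\<close>

lemma bounded_configuration_contains_cone:
  assumes "bounded_configuration \<theta> \<Gamma>"
  shows "0 < \<theta>" "\<theta> \<le> pi / 2" "contains_cone ((1 - cos \<theta>) / 4) (\<Gamma> x)"
proof -
  obtain a where a: "\<And>x. double_cone_with_angle (a x) (\<Gamma> x)" "\<theta> = (INF x. a x)" "0 < \<theta>"
    using assms by (auto simp: bounded_configuration_def)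
  have b: "0 < a x" "a x \<le> pi / 2" for x
    using a(1)[of x] by (auto simp: double_cone_with_angle_def)
  have "bdd_below (range a)"
    using b by (intro bdd_belowI[of _ 0]) (auto intro: less_imp_le)
  then have le: "\<theta> \<le> a x" for x
    unfolding a(2) by (rule cINF_lower) simp
  show "0 < \<theta>" by fact
  show th: "\<theta> \<le> pi / 2" using le[of x] b(2)[of x] by linarith
  obtain v where v: "norm v = 1" "\<Gamma> x = double_cone v (a x)"
    using a(1)[of x] by (auto simp: double_cone_with_angle_def)
  have c: "0 \<le> cos \<theta>" using a(3) th by (intro cos_ge_zero) auto
  have c1: "cos \<theta> < 1" using cos_monotone_0_pi[of 0 \<theta>] a(3) th pi_gt_zero by simp
  have ca: "cos (a x) \<le> cos \<theta>"
    using le[of x] b[of x] a(3) pi_gt_zero by (intro cos_monotone_0_pi_le) auto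
  have "h \<in> double_cone v (a x) \<and> - h \<in> double_cone v (a x)"
    if "t > 0" "norm (h - t *\<^sub>R v) < (1 - cos \<theta>) / 4 * t" for t h
    using ball_subset_cone_of[OF v(1) that(1) c c1 ca that(2)] by (simp add: double_cone_def)
  then show "contains_cone ((1 - cos \<theta>) / 4) (\<Gamma> x)"
    unfolding contains_cone_def v(2) using v(1) by (intro exI[of _ v]) simp
qed

text \<open>
  The double cone at \<open>y\<close> may be tangential to the sphere around \<open>p\<close>, but one half of it, tilted
  slightly towards \<open>p\<close>, enters the ball.
\<close>

lemma cone_meets_ball:
  fixes p y :: "real ^ 'd"
  assumes V: "contains_cone \<epsilon> V" and \<epsilon>: "0 < \<epsilon>" "\<epsilon> \<le> 1" and \<sigma>: "0 < \<sigma>"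
    and y: "norm (p - y) \<le> (1 + \<epsilon>\<^sup>2 / 384) * \<sigma>"
  obtains q where "\<And>w. w \<in> ball q (\<epsilon>\<^sup>2 / 256 * \<sigma>) \<Longrightarrow>
    w \<in> ball p \<sigma> \<and> w - y \<in> V \<and> \<epsilon> / 64 * \<sigma> \<le> norm (w - y)"
proof -
  define m where "m = p - y"
  define s where "s = \<epsilon> / 4" \<comment> \<open>amount of tilt; the constants 384 and 256 stand for \<open>s\<^sup>2 / 24\<close> and \<open>s\<^sup>2 / 16\<close>\<close>
  define \<delta> where "\<delta> = s\<^sup>2 / 24"
  have s: "0 < s" "s \<le> 1/4" using \<epsilon> by (auto simp: s_def)
  have s2: "s\<^sup>2 \<le> s" using s by (simp add: power2_eq_square mult_left_le)
  have \<delta>: "0 \<le> \<delta>" "\<delta> \<le> 1" using s s2 by (auto simp: \<delta>_def)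
  have m: "norm m \<le> (1 + \<delta>) * \<sigma>" using y by (simp add: m_def \<delta>_def s_def power_divide)
  \<comment> \<open>By symmetry of the double cone, the half is chosen whose axis does not point
    away from \<open>p\<close>.\<close>
  obtain v where v: "norm v = 1" "v \<bullet> m \<ge> 0"
    and vV: "\<And>t h. t > 0 \<Longrightarrow> norm (h - t *\<^sub>R v) < \<epsilon> * t \<Longrightarrow> h \<in> V"
  proof -
    obtain v where v: "norm v = 1"
      and vV: "\<And>t h. t > 0 \<Longrightarrow> norm (h - t *\<^sub>R v) < \<epsilon> * t \<Longrightarrow> h \<in> V \<and> - h \<in> V"
      using V by (auto simp: contains_cone_def)
    show ?thesis
    proof (cases "v \<bullet> m \<ge> 0")
      case True
      show ?thesis
      proof (rule that[OF v True])
        show "h \<in> V" if "t > 0" "norm (h - t *\<^sub>R v) < \<epsilon> * t" for t h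
          using vV[OF that] by simp
      qed
    next
      case False
      have "h \<in> V" if "t > 0" "norm (h - t *\<^sub>R (- v)) < \<epsilon> * t" for t h
      proof -
        have "norm (- h - t *\<^sub>R v) = norm (h - t *\<^sub>R (- v))"
          using norm_minus_cancel[of "h + t *\<^sub>R v"] by (simp add: algebra_simps)
        then show ?thesis using vV[of t "- h"] that by simp
      qed
      moreover have "norm (- v) = 1" "0 \<le> - v \<bullet> m" using v False by auto
      ultimately show ?thesis by (intro that[of "- v"])
    qed
  qed
  \<comment> \<open>The direction \<open>h\<close> is the axis tilted towards \<open>p\<close>, and
    \<open>q\<close> is reached from \<open>y\<close> by a step of size about
    \<open>t * \<sigma>\<close>. With \<open>t = s / 4\<close>, the gain \<open>2 * t * s\<close> in
    the squared distance to \<open>p\<close> is twice the quadratic loss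
    \<open>4 * t\<^sup>2\<close>.\<close>
  define h where "h = v + (s / \<sigma>) *\<^sub>R m"
  define t where "t = s / 4"
  define q where "q = y + (t * \<sigma>) *\<^sub>R h"
  have t: "0 < t" using s by (simp add: t_def)
  have hv: "norm (h - v) \<le> 2 * s"
  proof -
    have "norm (h - v) = s / \<sigma> * norm m" using s \<sigma> by (simp add: h_def)
    also have "\<dots> \<le> s / \<sigma> * ((1 + \<delta>) * \<sigma>)" using m s \<sigma> by (intro mult_left_mono) auto
    also have "\<dots> = s * (1 + \<delta>)" using \<sigma> by simp
    also have "\<dots> \<le> s * 2" using s \<delta> by (intro mult_left_mono) auto
    finally show ?thesis by simp
  qed
  have h1: "norm h \<le> 2" "1 / 2 \<le> norm h"
    using norm_triangle_sub[of h v] norm_triangle_sub[of v h] hv v s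
    by (auto simp: norm_minus_commute)
  \<comment> \<open>The axis contributes \<open>v \<bullet> m \<ge> 0\<close>; the tilt alone
    supplies the lower bound.\<close>
  have hm: "s / \<sigma> * (norm m)\<^sup>2 \<le> h \<bullet> m"
    using v by (simp add: h_def inner_add_left power2_norm_eq_inner)
  have qp: "norm (q - p) \<le> (1 - s\<^sup>2 / 16) * \<sigma>"
  proof (rule power2_le_imp_le)
    have "(norm (q - p))\<^sup>2 = (norm ((t * \<sigma>) *\<^sub>R h - m))\<^sup>2"
      by (simp add: q_def m_def algebra_simps)
    also have "\<dots> = (t * \<sigma> * norm h)\<^sup>2 - 2 * (t * \<sigma>) * (h \<bullet> m) + (norm m)\<^sup>2"
      unfolding power2_norm_eq_inner power_mult_distrib
      by (simp add: inner_diff_left inner_diff_right inner_commute power2_eq_square algebra_simps)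
    also have "\<dots> \<le> (t * \<sigma> * 2)\<^sup>2 - 2 * (t * \<sigma>) * (s / \<sigma> * (norm m)\<^sup>2) + (norm m)\<^sup>2"
    proof -
      have "(t * \<sigma> * norm h)\<^sup>2 \<le> (t * \<sigma> * 2)\<^sup>2"
        using h1 t \<sigma> by (intro power_mono mult_left_mono) auto
      moreover have "2 * (t * \<sigma>) * (s / \<sigma> * (norm m)\<^sup>2) \<le> 2 * (t * \<sigma>) * (h \<bullet> m)"
        using hm t \<sigma> by (intro mult_left_mono) auto
      ultimately show ?thesis by linarith
    qed
    also have "\<dots> = 4 * t\<^sup>2 * \<sigma>\<^sup>2 + (1 - 2 * t * s) * (norm m)\<^sup>2"
      using \<sigma> by (simp add: field_simps power2_eq_square)
    also have "\<dots> \<le> 4 * t\<^sup>2 * \<sigma>\<^sup>2 + (1 - 2 * t * s) * ((1 + \<delta>) * \<sigma>)\<^sup>2"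
    proof (intro add_left_mono mult_left_mono power_mono m)
      have "2 * t * s = s\<^sup>2 / 2" by (simp add: t_def power2_eq_square)
      then show "0 \<le> 1 - 2 * t * s" using s s2 by linarith
    qed simp
    also have "\<dots> = (4 * t\<^sup>2 + (1 - 2 * t * s) * (1 + \<delta>)\<^sup>2) * \<sigma>\<^sup>2"
      unfolding power_mult_distrib by (simp add: algebra_simps)
    also have "\<dots> \<le> (1 - s\<^sup>2 / 16)\<^sup>2 * \<sigma>\<^sup>2"
    proof (rule mult_right_mono)
      have "(1 + \<delta>)\<^sup>2 \<le> 1 + 3 * \<delta>"
        using \<delta> by (simp add: power2_eq_square algebra_simps mult_left_le)
      moreover have ts: "2 * t * s = s\<^sup>2 / 2" by (simp add: t_def power2_eq_square)
      moreover have "0 \<le> 1 - 2 * t * s" using ts s s2 by linarith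
      ultimately have "(1 - 2 * t * s) * (1 + \<delta>)\<^sup>2 \<le> (1 - 2 * t * s) * (1 + 3 * \<delta>)"
        by (intro mult_left_mono) auto
      also have "\<dots> = 1 + 3 * \<delta> - s\<^sup>2 / 2 - 3 * (\<delta> * (s\<^sup>2 / 2))"
        unfolding ts by (simp add: algebra_simps)
      also have "\<dots> \<le> 1 + 3 * \<delta> - s\<^sup>2 / 2" using \<delta> by simp
      \<comment> \<open>In units of \<open>s\<^sup>2\<close>, the losses are 1/4 from
        \<open>4 * t\<^sup>2\<close> and 1/8 from \<open>3 * \<delta>\<close>, the gain is 1/2 from
        \<open>2 * t * s\<close>; a gain of 1/8 remains.\<close>
      finally have "4 * t\<^sup>2 + (1 - 2 * t * s) * (1 + \<delta>)\<^sup>2 \<le> 1 - s\<^sup>2 / 8"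
        by (simp add: \<delta>_def t_def power_divide)
      also have "\<dots> \<le> (1 - s\<^sup>2 / 16)\<^sup>2"
        by (simp add: power2_diff power_divide)
      finally show "4 * t\<^sup>2 + (1 - 2 * t * s) * (1 + \<delta>)\<^sup>2 \<le> (1 - s\<^sup>2 / 16)\<^sup>2" .
    qed simp
    finally show "(norm (q - p))\<^sup>2 \<le> ((1 - s\<^sup>2 / 16) * \<sigma>)\<^sup>2" by (simp add: power_mult_distrib)
    show "0 \<le> (1 - s\<^sup>2 / 16) * \<sigma>" using s s2 \<sigma> by (intro mult_nonneg_nonneg) auto
  qed
  show ?thesis
  proof (rule that)
    fix w assume "w \<in> ball q (\<epsilon>\<^sup>2 / 256 * \<sigma>)"
    then have w: "norm (w - q) < s\<^sup>2 / 16 * \<sigma>"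
      by (simp add: dist_norm norm_minus_commute s_def power_divide)
    \<comment> \<open>The radius \<open>s\<^sup>2 / 16 * \<sigma>\<close> of the ball around
      \<open>q\<close> is exactly the margin left by \<open>qp\<close>.\<close>
    have "norm (w - p) < \<sigma>"
      using norm_triangle_ineq[of "w - q" "q - p"] w qp by (simp add: algebra_simps)
    moreover have "w - y \<in> V"
    proof (rule vV)
      show "0 < t * \<sigma>" using t \<sigma> by simp
      have "w - y - (t * \<sigma>) *\<^sub>R v = (w - q) + (t * \<sigma>) *\<^sub>R (h - v)"
        by (simp add: q_def algebra_simps)
      moreover have "norm ((t * \<sigma>) *\<^sub>R (h - v)) = t * \<sigma> * norm (h - v)"
        using t \<sigma> by simp
      ultimately have "norm (w - y - (t * \<sigma>) *\<^sub>R v) \<le> norm (w - q) + t * \<sigma> * norm (h - v)"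
        using norm_triangle_ineq[of "w - q" "(t * \<sigma>) *\<^sub>R (h - v)"] by metis
      also have "\<dots> < s\<^sup>2 / 16 * \<sigma> + t * \<sigma> * (2 * s)"
        using w hv t \<sigma> by (intro add_less_le_mono mult_left_mono) auto
      \<comment> \<open>Since \<open>\<epsilon> = 4 * s\<close>, the right side is
        \<open>s\<^sup>2 * \<sigma>\<close>, while the left side is 9/16 of it.\<close>
      also have "\<dots> \<le> \<epsilon> * (t * \<sigma>)"
        using s \<sigma> by (simp add: t_def s_def power2_eq_square field_simps)
      finally show "norm (w - y - (t * \<sigma>) *\<^sub>R v) < \<epsilon> * (t * \<sigma>)" .
    qed
    moreover have "\<epsilon> / 64 * \<sigma> \<le> norm (w - y)"
    proof -
      \<comment> \<open>The step from \<open>y\<close> to \<open>q\<close> has length at least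
        \<open>s / 8 * \<sigma>\<close>, of which the radius around \<open>q\<close> takes at most
        half. The result makes the links longer than \<open>R0\<close> once \<open>\<sigma>\<close>
        is large.\<close>
      have "(s / 16) * \<sigma> \<le> (s / 8 - s\<^sup>2 / 16) * \<sigma>"
        using s2 \<sigma> by (intro mult_right_mono) auto
      also have "\<dots> \<le> t * \<sigma> * norm h - s\<^sup>2 / 16 * \<sigma>"
        using mult_left_mono[OF h1(2), of "t * \<sigma>"] t \<sigma> by (simp add: t_def algebra_simps)
      also have "\<dots> \<le> norm ((t * \<sigma>) *\<^sub>R h) - norm (w - q)"
        using w t \<sigma> by simp
      also have "\<dots> \<le> norm ((t * \<sigma>) *\<^sub>R h + (w - q))"
        by (rule norm_diff_ineq)
      also have "(t * \<sigma>) *\<^sub>R h + (w - q) = w - y" by (simp add: q_def)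
      finally show ?thesis by (simp add: s_def)
    qed
    ultimately show "w \<in> ball p \<sigma> \<and> w - y \<in> V \<and> \<epsilon> / 64 * \<sigma> \<le> norm (w - y)"
      by (simp add: dist_norm norm_minus_commute)
  qed
qed

section \<open>Links and the spreading of bounds over growing balls\<close>

text \<open>Links are directed: only the cone at the first endpoint is tested. One of the two
  indicators in the lower bound for the kernel is then already 1.\<close>

definition links :: "(real ^ 'd \<Rightarrow> (real ^ 'd) set) \<Rightarrow> real \<Rightarrow> (real ^ 'd) set \<Rightarrow> ((real ^ 'd) \<times> (real ^ 'd)) set" where
  "links \<Gamma> R0 A = {(y, z). y \<in> A \<and> z \<in> A \<and> R0 < norm (y - z) \<and> z \<in> cone_at \<Gamma> y}"

text \<open>There is no kernel weight here, since powers of the scale are attached only when the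
  scales are added up.\<close>

definition energy :: "('a \<Rightarrow> real) \<Rightarrow> ('a \<times> 'a) set \<Rightarrow> real" where
  "energy f P = (\<Sum>(y, z)\<in>P. (f y - f z)\<^sup>2)"

lemma mem_cone_at_iff: "z \<in> cone_at \<Gamma> y \<longleftrightarrow> z - y \<in> \<Gamma> y"
  by (auto simp: cone_at_def image_iff algebra_simps intro: bexI[of _ "z - y"])

lemma links_subset: "links \<Gamma> R0 A \<subseteq> A \<times> A"
  by (auto simp: links_def)

lemma links_mono: "A \<subseteq> B \<Longrightarrow> links \<Gamma> R0 A \<subseteq> links \<Gamma> R0 B"
  by (auto simp: links_def)

lemma finite_links: "finite A \<Longrightarrow> finite (links \<Gamma> R0 A)"
  by (rule finite_subset[OF links_subset]) simp

lemma energy_nonneg: "0 \<le> energy f P"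
  by (auto simp: energy_def intro: sum_nonneg)

lemma energy_mono: "finite Q \<Longrightarrow> P \<subseteq> Q \<Longrightarrow> energy f P \<le> energy f Q"
  unfolding energy_def by (rule sum_mono2) auto

text \<open>Each \<open>y\<close> is compared with all \<open>z\<close> in \<open>S y\<close>
  through \<open>(a - f y)\<^sup>2 \<le> 2 * (a - f z)\<^sup>2 + 2 * (f y - f z)\<^sup>2\<close>.
  Enlarging \<open>S y\<close> to \<open>B\<close> in the first term makes it independent of
  \<open>y\<close>, whence the factor \<open>card A\<close>.\<close>

lemma sum_square_diff_transfer:
  fixes f :: "'a \<Rightarrow> real"
  assumes fin: "finite A" "finite B"
    and S: "\<And>y. y \<in> A \<Longrightarrow> S y \<subseteq> B" "\<And>y. y \<in> A \<Longrightarrow> m \<le> real (card (S y))"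
  shows "m * (\<Sum>y\<in>A. (a - f y)\<^sup>2) \<le>
    2 * (real (card A) * (\<Sum>z\<in>B. (a - f z)\<^sup>2) + energy f (Sigma A S))"
proof -
  have finS: "finite (S y)" if "y \<in> A" for y
    using S(1)[OF that] fin(2) by (rule finite_subset)
  have "m * (a - f y)\<^sup>2 \<le> 2 * (\<Sum>z\<in>B. (a - f z)\<^sup>2) + 2 * (\<Sum>z\<in>S y. (f y - f z)\<^sup>2)"
    if y: "y \<in> A" for y
  proof -
    have "m * (a - f y)\<^sup>2 \<le> real (card (S y)) * (a - f y)\<^sup>2"
      using S(2)[OF y] by (intro mult_right_mono) auto
    also have "\<dots> = (\<Sum>z\<in>S y. (a - f y)\<^sup>2)" by simp
    also have "\<dots> \<le> (\<Sum>z\<in>S y. 2 * (a - f z)\<^sup>2 + 2 * (f y - f z)\<^sup>2)"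
    proof (rule sum_mono)
      fix z
      have "0 \<le> ((a - f z) + (f y - f z))\<^sup>2" by simp
      then show "(a - f y)\<^sup>2 \<le> 2 * (a - f z)\<^sup>2 + 2 * (f y - f z)\<^sup>2"
        by (simp add: power2_eq_square algebra_simps)
    qed
    also have "\<dots> = 2 * (\<Sum>z\<in>S y. (a - f z)\<^sup>2) + 2 * (\<Sum>z\<in>S y. (f y - f z)\<^sup>2)"
      by (simp add: sum.distrib sum_distrib_left)
    also have "(\<Sum>z\<in>S y. (a - f z)\<^sup>2) \<le> (\<Sum>z\<in>B. (a - f z)\<^sup>2)"
      using fin S(1)[OF y] by (intro sum_mono2) auto
    finally show ?thesis by simp
  qed
  then have "(\<Sum>y\<in>A. m * (a - f y)\<^sup>2) \<le>
      (\<Sum>y\<in>A. 2 * (\<Sum>z\<in>B. (a - f z)\<^sup>2) + 2 * (\<Sum>z\<in>S y. (f y - f z)\<^sup>2))"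
    by (rule sum_mono)
  also have "\<dots> = 2 * (real (card A) * (\<Sum>z\<in>B. (a - f z)\<^sup>2)) + 2 * (\<Sum>y\<in>A. \<Sum>z\<in>S y. (f y - f z)\<^sup>2)"
    by (simp add: sum.distrib sum_distrib_left mult.left_commute)
  also have "(\<Sum>y\<in>A. \<Sum>z\<in>S y. (f y - f z)\<^sup>2) = energy f (Sigma A S)"
    unfolding energy_def using fin finS by (intro sum.Sigma) auto
  finally show ?thesis by (simp add: sum_distrib_left)
qed

text \<open>Every \<open>y\<close> in the larger ball is linked to a ball of radius
  \<open>\<epsilon>\<^sup>2 / 256 * \<sigma>\<close> inside the smaller one. Numbers of lattice
  points on both sides are of order \<open>\<sigma> ^ CARD('d)\<close>, so averaging over these
  links costs a constant free of \<open>\<sigma>\<close>.\<close>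

lemma ball_growth:
  fixes \<epsilon> R0 :: real
  assumes \<epsilon>: "0 < \<epsilon>" "\<epsilon> \<le> 1" and R0: "0 < R0"
  obtains C \<sigma>0 :: real where "C \<ge> 1" "\<sigma>0 \<ge> 1"
    "\<And>(\<Gamma> :: real ^ 'd \<Rightarrow> (real ^ 'd) set) \<sigma> p a f. (\<And>x. contains_cone \<epsilon> (\<Gamma> x)) \<Longrightarrow> \<sigma>0 \<le> \<sigma> \<Longrightarrow>
      (\<Sum>y\<in>ball p ((1 + \<epsilon>\<^sup>2 / 384) * \<sigma>) \<inter> int_lattice. (a - f y)\<^sup>2) \<le>
      C * ((\<Sum>z\<in>ball p \<sigma> \<inter> int_lattice. (a - f z)\<^sup>2) +
           energy f (links \<Gamma> R0 (ball p ((1 + \<epsilon>\<^sup>2 / 384) * \<sigma>) \<inter> int_lattice)) / \<sigma> ^ CARD('d))"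
proof -
  define d where "d = CARD('d)"
  have d: "0 < real d" by (simp add: d_def)
  define \<eta> where "\<eta> = \<epsilon>\<^sup>2 / 256"
  define \<mu> where "\<mu> = (\<eta> / (2 * real d)) ^ d"
  have \<eta>: "0 < \<eta>" using \<epsilon> by (simp add: \<eta>_def)
  have \<mu>: "0 < \<mu>" using \<eta> d by (simp add: \<mu>_def)
  define C where "C = 1 + 2 * 6 ^ d / \<mu>"
  \<comment> \<open>The second summand makes the radius \<open>\<eta> * \<sigma>\<close> large
    enough for the lower count of lattice points, the third makes the links longer than
    \<open>R0\<close>.\<close>
  define \<sigma>0 where "\<sigma>0 = 1 + 2 * real d / \<eta> + 64 * (R0 + 1) / \<epsilon>"
  have \<sigma>0: "1 \<le> \<sigma>0" "2 * real d / \<eta> \<le> \<sigma>0" "64 * (R0 + 1) / \<epsilon> \<le> \<sigma>0"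
    using d \<eta> \<epsilon> R0 by (simp_all add: \<sigma>0_def)
  show thesis
  proof (rule that)
    show "1 \<le> C" using \<mu> by (simp add: C_def)
    show "1 \<le> \<sigma>0" by fact
  next
    fix \<Gamma> :: "real ^ 'd \<Rightarrow> (real ^ 'd) set" and \<sigma> a :: real
      and p :: "real ^ 'd" and f :: "real ^ 'd \<Rightarrow> real"
    assume \<Gamma>: "\<And>x. contains_cone \<epsilon> (\<Gamma> x)" and \<sigma>: "\<sigma>0 \<le> \<sigma>"
    define A where "A = ball p ((1 + \<epsilon>\<^sup>2 / 384) * \<sigma>) \<inter> int_lattice"
    define B where "B = ball p \<sigma> \<inter> int_lattice"
    have \<sigma>1: "1 \<le> \<sigma>" using \<sigma> \<sigma>0 by linarith
    have \<epsilon>2: "\<epsilon>\<^sup>2 \<le> 1" using \<epsilon> by (simp add: power_le_one)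
    have big: "2 * real d \<le> \<eta> * \<sigma>" "R0 < \<epsilon> / 64 * \<sigma>"
    proof -
      have "2 * real d / \<eta> \<le> \<sigma>" "64 * (R0 + 1) / \<epsilon> \<le> \<sigma>" using \<sigma>0 \<sigma> by linarith+
      then show "2 * real d \<le> \<eta> * \<sigma>" "R0 < \<epsilon> / 64 * \<sigma>"
        using \<eta> \<epsilon> by (simp_all add: pos_divide_le_eq mult.commute)
    qed
    have "\<exists>q. \<forall>w\<in>ball q (\<eta> * \<sigma>). w \<in> ball p \<sigma> \<and> w - y \<in> \<Gamma> y \<and> \<epsilon> / 64 * \<sigma> \<le> norm (w - y)"
      if "y \<in> A" for y
    proof -
      have "norm (p - y) \<le> (1 + \<epsilon>\<^sup>2 / 384) * \<sigma>" using that by (simp add: A_def dist_norm)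
      moreover have "0 < \<sigma>" using \<sigma>1 by simp
      ultimately obtain q where "\<And>w. w \<in> ball q (\<epsilon>\<^sup>2 / 256 * \<sigma>) \<Longrightarrow>
          w \<in> ball p \<sigma> \<and> w - y \<in> \<Gamma> y \<and> \<epsilon> / 64 * \<sigma> \<le> norm (w - y)"
        using cone_meets_ball[OF \<Gamma>[of y] \<epsilon>] by metis
      then show ?thesis unfolding \<eta>_def by (intro exI[of _ q] ballI)
    qed
    then obtain q where q: "\<And>y w. y \<in> A \<Longrightarrow> w \<in> ball (q y) (\<eta> * \<sigma>) \<Longrightarrow>
        w \<in> ball p \<sigma> \<and> w - y \<in> \<Gamma> y \<and> \<epsilon> / 64 * \<sigma> \<le> norm (w - y)"
      by metis
    define S where "S y = ball (q y) (\<eta> * \<sigma>) \<inter> int_lattice" for y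
    have fin: "finite A" "finite B" by (simp_all add: A_def B_def finite_lattice_ball)
    have BA: "B \<subseteq> A"
    proof -
      have "\<sigma> \<le> (1 + \<epsilon>\<^sup>2 / 384) * \<sigma>" using \<sigma>1 by (simp add: algebra_simps)
      then show ?thesis by (auto simp: A_def B_def)
    qed
    have SB: "S y \<subseteq> B" if "y \<in> A" for y
      using q[OF that] by (auto simp: S_def B_def)
    have "\<mu> * \<sigma> ^ d = (\<eta> * \<sigma> / (2 * real d)) ^ d"
      by (simp add: \<mu>_def power_mult_distrib power_divide)
    then have Scard: "\<mu> * \<sigma> ^ d \<le> real (card (S y))" for y
      using card_lattice_ball_ge[of "\<eta> * \<sigma>" "q y"] big(1) by (simp add: S_def d_def)
    have Acard: "real (card A) \<le> 6 ^ d * \<sigma> ^ d"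
    proof -
      have le: "(1 + \<epsilon>\<^sup>2 / 384) * \<sigma> \<le> 2 * \<sigma>" using \<epsilon>2 \<sigma>1 by (intro mult_right_mono) auto
      have "A \<subseteq> ball p (2 * \<sigma>) \<inter> int_lattice"
        using le by (auto simp: A_def)
      then have "real (card A) \<le> real (card (ball p (2 * \<sigma>) \<inter> int_lattice))"
        by (intro of_nat_mono card_mono finite_lattice_ball)
      also have "\<dots> \<le> (3 * (2 * \<sigma>)) ^ d"
        unfolding d_def using \<sigma>1 by (intro card_lattice_ball_le) simp
      finally show ?thesis by (simp add: power_mult_distrib)
    qed
    have "Sigma A S \<subseteq> links \<Gamma> R0 A"
    proof
      fix e assume "e \<in> Sigma A S"
      then obtain y z where e: "e = (y, z)" "y \<in> A" "z \<in> S y" by auto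
      have "z \<in> ball (q y) (\<eta> * \<sigma>)" using e by (simp add: S_def)
      from q[OF e(2) this] have "z - y \<in> \<Gamma> y" "R0 < norm (y - z)"
        using big(2) by (simp_all add: norm_minus_commute)
      then show "e \<in> links \<Gamma> R0 A"
        using SB[OF e(2)] BA e by (auto simp: links_def mem_cone_at_iff)
    qed
    then have en: "energy f (Sigma A S) \<le> energy f (links \<Gamma> R0 A)"
      by (intro energy_mono finite_links fin)
    define Q where "Q = (\<Sum>z\<in>B. (a - f z)\<^sup>2)"
    define E where "E = energy f (links \<Gamma> R0 A)"
    have QE: "0 \<le> Q" "0 \<le> E" by (simp_all add: Q_def E_def sum_nonneg energy_nonneg)
    have "(\<mu> * \<sigma> ^ d) * (\<Sum>y\<in>A. (a - f y)\<^sup>2) \<le> 2 * (real (card A) * Q + energy f (Sigma A S))"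
      unfolding Q_def by (rule sum_square_diff_transfer[OF fin SB Scard])
    also have "\<dots> \<le> 2 * (6 ^ d * \<sigma> ^ d * Q + 6 ^ d * E)"
    proof -
      have "real (card A) * Q \<le> 6 ^ d * \<sigma> ^ d * Q" using Acard QE(1) by (rule mult_right_mono)
      moreover have "1 * E \<le> 6 ^ d * E" using QE by (intro mult_right_mono) auto
      ultimately show ?thesis using en by (simp add: E_def)
    qed
    also have "\<dots> = (\<mu> * \<sigma> ^ d) * (2 * 6 ^ d / \<mu> * (Q + E / \<sigma> ^ d))"
      using \<mu> \<sigma>1 by (simp add: field_simps)
    finally have "(\<Sum>y\<in>A. (a - f y)\<^sup>2) \<le> 2 * 6 ^ d / \<mu> * (Q + E / \<sigma> ^ d)"
      using \<mu> \<sigma>1 by (subst (asm) mult_le_cancel_left_pos) simp_all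
    also have "\<dots> \<le> C * (Q + E / \<sigma> ^ d)"
      using QE \<sigma>1 by (intro mult_right_mono) (auto simp: C_def)
    finally show "(\<Sum>y\<in>ball p ((1 + \<epsilon>\<^sup>2 / 384) * \<sigma>) \<inter> int_lattice. (a - f y)\<^sup>2) \<le>
      C * ((\<Sum>z\<in>ball p \<sigma> \<inter> int_lattice. (a - f z)\<^sup>2) +
           energy f (links \<Gamma> R0 (ball p ((1 + \<epsilon>\<^sup>2 / 384) * \<sigma>) \<inter> int_lattice)) / \<sigma> ^ CARD('d))"
      unfolding A_def B_def Q_def E_def d_def .
  qed
qed

text \<open>The start is a ball of radius \<open>\<epsilon> * r\<close> in the cone at
  \<open>x\<close>, centred at distance \<open>r\<close>, whose lattice points are all linked to
  \<open>x\<close>. A number \<open>K\<close> of enlargements depending only on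
  \<open>\<epsilon>\<close> makes it cover the ball of radius \<open>r\<close> around
  \<open>x\<close>.\<close>

lemma growing_ball_bound:
  fixes \<epsilon> R0 :: real
  assumes \<epsilon>: "0 < \<epsilon>" "\<epsilon> \<le> 1 / 4" and R0: "0 < R0"
  obtains C M r0 :: real where "C \<ge> 1" "M \<ge> 1" "r0 \<ge> 1"
    "\<And>(\<Gamma> :: real ^ 'd \<Rightarrow> (real ^ 'd) set) r x f. (\<And>x. contains_cone \<epsilon> (\<Gamma> x)) \<Longrightarrow>
      r0 \<le> r \<Longrightarrow> x \<in> int_lattice \<Longrightarrow>
      (\<Sum>y\<in>ball x r \<inter> int_lattice. (f x - f y)\<^sup>2) \<le>
      C * ((\<Sum>z\<in>{z. (x, z) \<in> links \<Gamma> R0 (ball x (M * r) \<inter> int_lattice)}. (f x - f z)\<^sup>2) +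
           energy f (links \<Gamma> R0 (ball x (M * r) \<inter> int_lattice)) / r ^ CARD('d))"
proof -
  have \<epsilon>1: "\<epsilon> \<le> 1" using \<epsilon> by simp
  obtain C1 \<sigma>0 :: real where C1: "C1 \<ge> 1" and \<sigma>0: "\<sigma>0 \<ge> 1"
    and growth: "\<And>(\<Gamma> :: real ^ 'd \<Rightarrow> (real ^ 'd) set) \<sigma> p a f. (\<And>x. contains_cone \<epsilon> (\<Gamma> x)) \<Longrightarrow> \<sigma>0 \<le> \<sigma> \<Longrightarrow>
      (\<Sum>y\<in>ball p ((1 + \<epsilon>\<^sup>2 / 384) * \<sigma>) \<inter> int_lattice. (a - f y)\<^sup>2) \<le>
      C1 * ((\<Sum>z\<in>ball p \<sigma> \<inter> int_lattice. (a - f z)\<^sup>2) +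
           energy f (links \<Gamma> R0 (ball p ((1 + \<epsilon>\<^sup>2 / 384) * \<sigma>) \<inter> int_lattice)) / \<sigma> ^ CARD('d))"
    by (rule ball_growth[OF \<epsilon>(1) \<epsilon>1 R0, where 'd = 'd]) blast
  define d where "d = CARD('d)"
  define \<beta> where "\<beta> = 1 + \<epsilon>\<^sup>2 / 384"
  have \<beta>: "1 < \<beta>" using \<epsilon> by (simp add: \<beta>_def)
  \<comment> \<open>The final radius \<open>\<beta> ^ K * (\<epsilon> * r)\<close> has to reach
    \<open>2 * r\<close>, as the centre is at distance \<open>r\<close> from \<open>x\<close>. Then
    \<open>M * r\<close> is this radius plus \<open>r\<close>.\<close>
  obtain K where K: "2 / \<epsilon> < \<beta> ^ K" using real_arch_pow[OF \<beta>] by blast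
  define M where "M = 1 + \<epsilon> * \<beta> ^ K"
  define u where "u = \<sigma>0 / \<epsilon>"
  have u: "0 \<le> u" using \<sigma>0 \<epsilon> by (simp add: u_def)
  \<comment> \<open>The summand \<open>u\<close> gives the initial radius
    \<open>\<epsilon> * r\<close> at least the size \<open>\<sigma>0\<close>; the rest makes links
    from \<open>x\<close> to the initial ball, of length at least \<open>3 / 4 * r\<close>, longer
    than \<open>R0\<close>.\<close>
  define r0 where "r0 = u + (2 * R0 + 2)"
  \<comment> \<open>The additional factor accounts for dividing by \<open>r ^ d\<close> in place of
    \<open>(\<epsilon> * r) ^ d\<close>.\<close>
  define C2 where "C2 = C1 * (1 + 1 / \<epsilon> ^ d)"
  have C2: "1 \<le> C2"
  proof -
    have "1 * 1 \<le> C1 * (1 + 1 / \<epsilon> ^ d)" using C1 \<epsilon> by (intro mult_mono) auto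
    then show ?thesis by (simp add: C2_def)
  qed
  show thesis
  proof (rule that)
    show "1 \<le> (2 * C2) ^ K" using C2 by (intro one_le_power) simp
    show "1 \<le> M" using \<epsilon> \<beta> by (simp add: M_def)
    show "1 \<le> r0" using u R0 unfolding r0_def by linarith
  next
    fix \<Gamma> :: "real ^ 'd \<Rightarrow> (real ^ 'd) set" and r :: real
      and x :: "real ^ 'd" and f :: "real ^ 'd \<Rightarrow> real"
    assume \<Gamma>: "\<And>x. contains_cone \<epsilon> (\<Gamma> x)" and r: "r0 \<le> r" and x: "x \<in> int_lattice"
    have rr: "u \<le> r" "(2 * R0 + 2) \<le> r" "0 < r"
      using r u R0 unfolding r0_def by linarith+
    obtain v where v: "norm v = 1"
      and vV: "\<And>t h. t > 0 \<Longrightarrow> norm (h - t *\<^sub>R v) < \<epsilon> * t \<Longrightarrow> h \<in> \<Gamma> x"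
      using \<Gamma>[of x] unfolding contains_cone_def by metis
    define p where "p = x + r *\<^sub>R v"
    define B where "B = ball x (M * r) \<inter> int_lattice"
    define D where "D k = ball p (\<beta> ^ k * (\<epsilon> * r)) \<inter> int_lattice" for k :: nat
    define Q where "Q k = (\<Sum>z\<in>D k. (f x - f z)\<^sup>2)" for k
    define H where "H = (\<Sum>z\<in>{z. (x, z) \<in> links \<Gamma> R0 B}. (f x - f z)\<^sup>2)"
    define E where "E = energy f (links \<Gamma> R0 B)"
    define T where "T = H + E / r ^ d"
    have HE: "0 \<le> H" "0 \<le> E" by (simp_all add: H_def E_def sum_nonneg energy_nonneg)
    then have T: "0 \<le> T" "H \<le> T" "E / r ^ d \<le> T" using rr by (simp_all add: T_def)
    have finB: "finite B" by (simp add: B_def finite_lattice_ball)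
    have fin1: "finite {z. (x, z) \<in> links \<Gamma> R0 B}"
      by (rule finite_subset[OF _ finB]) (auto simp: links_def)
    have xp: "dist x p = r" using v rr by (simp add: p_def dist_norm)
    have DB: "D k \<subseteq> B" if "k \<le> K" for k
    proof
      fix z assume z: "z \<in> D k"
      have "\<beta> ^ k * (\<epsilon> * r) \<le> \<beta> ^ K * (\<epsilon> * r)"
        using that \<beta> \<epsilon> rr by (intro mult_right_mono power_increasing) auto
      moreover have "dist x z \<le> dist x p + dist p z" by (rule dist_triangle)
      ultimately have "dist x z < r + \<beta> ^ K * (\<epsilon> * r)" using z xp by (simp add: D_def)
      also have "\<dots> = M * r" by (simp add: M_def algebra_simps)
      finally show "z \<in> B" using z by (simp add: B_def D_def)
    qed
    have "Q 0 \<le> H"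
      unfolding Q_def H_def
    proof (rule sum_mono2[OF fin1])
      show "D 0 \<subseteq> {z. (x, z) \<in> links \<Gamma> R0 B}"
      proof
        fix z assume z: "z \<in> D 0"
        have zp: "norm (z - x - r *\<^sub>R v) < \<epsilon> * r"
          using z by (simp add: D_def p_def dist_norm norm_minus_commute algebra_simps)
        have "r \<le> norm (z - x) + norm (z - x - r *\<^sub>R v)"
          using norm_triangle_ineq4[of "z - x" "z - x - r *\<^sub>R v"] v rr by simp
        moreover have "\<epsilon> * r \<le> 1 / 4 * r" using \<epsilon> rr by (intro mult_right_mono) auto
        ultimately have "R0 < norm (z - x)" using zp rr R0 by linarith
        moreover have "x \<in> B"
          using x rr \<epsilon> \<beta> by (auto simp: B_def M_def intro!: mult_pos_pos add_pos_nonneg)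
        moreover have "z \<in> B" using DB[of 0] z by auto
        ultimately show "z \<in> {z. (x, z) \<in> links \<Gamma> R0 B}"
          using vV[OF rr(3) zp] by (simp add: links_def mem_cone_at_iff norm_minus_commute)
      qed
    qed simp
    \<comment> \<open>All intermediate energies are at most \<open>E\<close>, so
      \<open>Q (Suc k) \<le> C2 * (Q k + T)\<close>. As \<open>T \<le> (2 * C2) ^ k * T\<close>,
      each step costs a factor \<open>2 * C2\<close>.\<close>
    have "Q k \<le> (2 * C2) ^ k * T" if "k \<le> K" for k
      using that
    proof (induction k)
      case 0
      then show ?case using \<open>Q 0 \<le> H\<close> T by simp
    next
      case (Suc k)
      define \<sigma> where "\<sigma> = \<beta> ^ k * (\<epsilon> * r)"
      have \<sigma>: "\<epsilon> * r \<le> \<sigma>"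
        using \<beta> \<epsilon> rr mult_right_mono[of 1 "\<beta> ^ k" "\<epsilon> * r"] by (simp add: \<sigma>_def)
      moreover have "\<sigma>0 \<le> \<epsilon> * r" using rr \<epsilon> by (simp add: u_def pos_divide_le_eq mult.commute)
      ultimately have \<sigma>\<sigma>: "\<sigma>0 \<le> \<sigma>" by simp
      have Dk: "D k = ball p \<sigma> \<inter> int_lattice" "D (Suc k) = ball p (\<beta> * \<sigma>) \<inter> int_lattice"
        by (simp_all add: D_def \<sigma>_def mult.assoc)
      have "Q (Suc k) \<le> C1 * (Q k + energy f (links \<Gamma> R0 (D (Suc k))) / \<sigma> ^ d)"
        unfolding Q_def Dk \<beta>_def d_def by (rule growth[OF \<Gamma> \<sigma>\<sigma>])
      also have "\<dots> \<le> C1 * (Q k + E / (\<epsilon> * r) ^ d)"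
      proof (intro mult_left_mono add_left_mono frac_le power_mono \<sigma>)
        show "energy f (links \<Gamma> R0 (D (Suc k))) \<le> E"
          unfolding E_def by (intro energy_mono finite_links finB links_mono DB Suc.prems)
      qed (use HE rr \<epsilon> C1 in auto)
      also have "\<dots> = C1 * (Q k + 1 / \<epsilon> ^ d * (E / r ^ d))" by (simp add: power_mult_distrib)
      also have "\<dots> \<le> C2 * (Q k + T)"
      proof -
        have "0 \<le> Q k" by (simp add: Q_def sum_nonneg)
        moreover have "1 / \<epsilon> ^ d * (E / r ^ d) \<le> 1 / \<epsilon> ^ d * T"
          using T \<epsilon> by (intro mult_left_mono) auto
        moreover have "0 \<le> 1 / \<epsilon> ^ d * Q k" using \<open>0 \<le> Q k\<close> \<epsilon> by simp
        ultimately have "Q k + 1 / \<epsilon> ^ d * (E / r ^ d) \<le> (1 + 1 / \<epsilon> ^ d) * (Q k + T)"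
          using T unfolding distrib_left distrib_right by linarith
        then show ?thesis
          using C1 unfolding C2_def mult.assoc by (intro mult_left_mono) auto
      qed
      also have "\<dots> \<le> C2 * ((2 * C2) ^ k * T + (2 * C2) ^ k * T)"
      proof (intro mult_left_mono add_mono)
        show "Q k \<le> (2 * C2) ^ k * T" using Suc by simp
        have "1 * T \<le> (2 * C2) ^ k * T"
          using C2 T by (intro mult_right_mono one_le_power) auto
        then show "T \<le> (2 * C2) ^ k * T" by simp
      qed (use C2 in simp)
      also have "\<dots> = (2 * C2) ^ Suc k * T" by (simp add: power_mult_distrib mult_ac)
      finally show ?case .
    qed
    then have QK: "Q K \<le> (2 * C2) ^ K * T" by simp
    have "(\<Sum>y\<in>ball x r \<inter> int_lattice. (f x - f y)\<^sup>2) \<le> Q K"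
      unfolding Q_def
    proof (rule sum_mono2)
      show "finite (D K)" by (simp add: D_def finite_lattice_ball)
      have "2 \<le> \<beta> ^ K * \<epsilon>" using K \<epsilon> by (simp add: pos_divide_less_eq)
      then have le: "2 * r \<le> \<beta> ^ K * \<epsilon> * r" using rr by (intro mult_right_mono) auto
      have "ball x r \<subseteq> ball p (\<beta> ^ K * (\<epsilon> * r))"
      proof
        fix y assume "y \<in> ball x r"
        then have "dist p y < 2 * r"
          using dist_triangle[of p y x] xp by (simp add: dist_commute)
        then show "y \<in> ball p (\<beta> ^ K * (\<epsilon> * r))"
          using le by (simp add: mult.assoc)
      qed
      then show "ball x r \<inter> int_lattice \<subseteq> D K" by (auto simp: D_def)
    qed simp
    also note QK
    finally show "(\<Sum>y\<in>ball x r \<inter> int_lattice. (f x - f y)\<^sup>2) \<le>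
      (2 * C2) ^ K * ((\<Sum>z\<in>{z. (x, z) \<in> links \<Gamma> R0 (ball x (M * r) \<inter> int_lattice)}. (f x - f z)\<^sup>2) +
           energy f (links \<Gamma> R0 (ball x (M * r) \<inter> int_lattice)) / r ^ CARD('d))"
      unfolding T_def H_def E_def B_def d_def .
  qed
qed

section \<open>Comparison at a single scale\<close>

text \<open>The pointwise bounds are summed over \<open>x\<close>. Links starting at
  \<open>x\<close> are counted once by their first endpoint; in the averaged term a link recurs for
  at most \<open>(3 * (M * r)) ^ CARD('d)\<close> points \<open>x\<close>, which the division by
  \<open>r ^ CARD('d)\<close> compensates. The bound on the length of the links is kept for the
  summation over scales.\<close>

lemma single_scale_bound:
  fixes \<epsilon> R0 :: real
  assumes \<epsilon>: "0 < \<epsilon>" "\<epsilon> \<le> 1 / 4" and R0: "0 < R0"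
  obtains C M r0 :: real where "C \<ge> 1" "M \<ge> 1" "r0 \<ge> 1"
    "\<And>(\<Gamma> :: real ^ 'd \<Rightarrow> (real ^ 'd) set) r x0 R f. (\<And>x. contains_cone \<epsilon> (\<Gamma> x)) \<Longrightarrow> r0 \<le> r \<Longrightarrow>
      (\<Sum>x\<in>ball x0 R \<inter> int_lattice. \<Sum>y\<in>ball x r \<inter> int_lattice. (f x - f y)\<^sup>2) \<le>
      C * energy f {(y, z) \<in> links \<Gamma> R0 (ball x0 (R + M * r) \<inter> int_lattice). norm (y - z) < 2 * (M * r)}"
proof -
  obtain C M r0 :: real where C: "C \<ge> 1" and M: "M \<ge> 1" and r0: "r0 \<ge> 1"
    and bound: "\<And>(\<Gamma> :: real ^ 'd \<Rightarrow> (real ^ 'd) set) r x f. (\<And>x. contains_cone \<epsilon> (\<Gamma> x)) \<Longrightarrow>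
      r0 \<le> r \<Longrightarrow> x \<in> int_lattice \<Longrightarrow>
      (\<Sum>y\<in>ball x r \<inter> int_lattice. (f x - f y)\<^sup>2) \<le>
      C * ((\<Sum>z\<in>{z. (x, z) \<in> links \<Gamma> R0 (ball x (M * r) \<inter> int_lattice)}. (f x - f z)\<^sup>2) +
           energy f (links \<Gamma> R0 (ball x (M * r) \<inter> int_lattice)) / r ^ CARD('d))"
    by (rule growing_ball_bound[OF \<epsilon> R0, where 'd = 'd]) blast
  define d where "d = CARD('d)"
  show thesis
  proof (rule that[OF _ M r0])
    have "1 * 1 \<le> C * (1 + (3 * M) ^ d)" using C M by (intro mult_mono) auto
    then show "1 \<le> C * (1 + (3 * M) ^ d)" by simp
  next
    fix \<Gamma> :: "real ^ 'd \<Rightarrow> (real ^ 'd) set" and r R :: real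
      and x0 :: "real ^ 'd" and f :: "real ^ 'd \<Rightarrow> real"
    assume \<Gamma>: "\<And>x. contains_cone \<epsilon> (\<Gamma> x)" and r: "r0 \<le> r"
    define A where "A = ball x0 R \<inter> int_lattice"
    define L where "L x = links \<Gamma> R0 (ball x (M * r) \<inter> int_lattice)" for x
    define P where "P = {(y, z) \<in> links \<Gamma> R0 (ball x0 (R + M * r) \<inter> int_lattice). norm (y - z) < 2 * (M * r)}"
    have r1: "1 \<le> r" using r r0 by simp
    have Mr: "1 \<le> M * r" using mult_mono[of 1 M 1 r] M r1 by simp
    have finA: "finite A" by (simp add: A_def finite_lattice_ball)
    have finL: "finite (L x)" for x by (simp add: L_def finite_links finite_lattice_ball)
    have finP: "finite P"
      by (rule finite_subset[of _ "links \<Gamma> R0 (ball x0 (R + M * r) \<inter> int_lattice)"])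
        (auto simp: P_def finite_links finite_lattice_ball)
    have LP: "L x \<subseteq> P" if "x \<in> A" for x
    proof
      fix e assume "e \<in> L x"
      then obtain y z where e: "e = (y, z)" "(y, z) \<in> L x" by (cases e) auto
      have yz: "dist x y < M * r" "dist x z < M * r" using e by (auto simp: L_def links_def)
      have "dist x0 x < R" using that by (simp add: A_def)
      then have "dist x0 y < R + M * r" "dist x0 z < R + M * r"
        using dist_triangle[of x0 y x] dist_triangle[of x0 z x] yz by linarith+
      moreover have "norm (y - z) < 2 * (M * r)"
        using dist_triangle3[of y z x] yz by (simp add: dist_norm)
      ultimately show "e \<in> P" using e by (simp add: P_def L_def links_def)
    qed
    have nn: "0 \<le> (\<lambda>(y, z). (f y - f z)\<^sup>2) e" for e :: "(real ^ 'd) \<times> (real ^ 'd)"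
      by (cases e) simp
    have first: "(\<Sum>x\<in>A. \<Sum>z\<in>{z. (x, z) \<in> L x}. (f x - f z)\<^sup>2) \<le> energy f P"
    proof -
      have "finite {z. (x, z) \<in> L x}" for x
        by (rule finite_subset[OF _ finite_imageI[OF finL[of x], of snd]]) force
      then have "(\<Sum>x\<in>A. \<Sum>z\<in>{z. (x, z) \<in> L x}. (f x - f z)\<^sup>2) =
          energy f (Sigma A (\<lambda>x. {z. (x, z) \<in> L x}))"
        unfolding energy_def using finA by (intro sum.Sigma) auto
      also have "\<dots> \<le> energy f P" using LP by (intro energy_mono finP) auto
      finally show ?thesis .
    qed
    have second: "(\<Sum>x\<in>A. energy f (L x)) \<le> (3 * (M * r)) ^ d * energy f P"
    proof -
      let ?g = "\<lambda>(y, z). (f y - f z)\<^sup>2"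
      have "(\<Sum>x\<in>A. energy f (L x)) = (\<Sum>x\<in>A. \<Sum>e\<in>{e\<in>P. e \<in> L x}. ?g e)"
        unfolding energy_def using LP by (intro sum.cong) auto
      also have "\<dots> = (\<Sum>e\<in>P. \<Sum>x\<in>{x\<in>A. e \<in> L x}. ?g e)"
        by (rule sum.swap_restrict[OF finA finP])
      also have "\<dots> \<le> (\<Sum>e\<in>P. (3 * (M * r)) ^ d * ?g e)"
      proof (rule sum_mono)
        fix e assume "e \<in> P"
        \<comment> \<open>A link seen from \<open>x\<close> has its first endpoint within
          \<open>M * r\<close> of \<open>x\<close>, so counting lattice points bounds the
          overlap.\<close>
        have "{x\<in>A. e \<in> L x} \<subseteq> ball (fst e) (M * r) \<inter> int_lattice"
          by (auto simp: A_def L_def links_def dist_commute)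
        then have "real (card {x\<in>A. e \<in> L x}) \<le> real (card (ball (fst e) (M * r) \<inter> int_lattice))"
          by (intro of_nat_mono card_mono finite_lattice_ball)
        also have "\<dots> \<le> (3 * (M * r)) ^ d"
          unfolding d_def by (rule card_lattice_ball_le[OF Mr])
        finally show "(\<Sum>x\<in>{x\<in>A. e \<in> L x}. ?g e) \<le> (3 * (M * r)) ^ d * ?g e"
          using nn[of e] by (simp only: sum_constant) (rule mult_right_mono)
      qed
      finally show ?thesis by (simp add: energy_def sum_distrib_left)
    qed
    have "(\<Sum>x\<in>A. \<Sum>y\<in>ball x r \<inter> int_lattice. (f x - f y)\<^sup>2) \<le>
        (\<Sum>x\<in>A. C * ((\<Sum>z\<in>{z. (x, z) \<in> L x}. (f x - f z)\<^sup>2) + energy f (L x) / r ^ d))"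
      unfolding L_def d_def by (intro sum_mono bound[OF \<Gamma> r]) (simp add: A_def)
    also have "\<dots> = C * ((\<Sum>x\<in>A. \<Sum>z\<in>{z. (x, z) \<in> L x}. (f x - f z)\<^sup>2) + (\<Sum>x\<in>A. energy f (L x)) / r ^ d)"
      by (simp only: sum.distrib sum_distrib_left[symmetric] sum_divide_distrib[symmetric])
    also have "\<dots> \<le> C * (energy f P + (3 * (M * r)) ^ d * energy f P / r ^ d)"
      using first second C r1 by (intro mult_left_mono add_mono divide_right_mono) auto
    also have "\<dots> = C * (1 + (3 * M) ^ d) * energy f P"
      using r1 by (simp add: power_mult_distrib field_simps)
    finally show "(\<Sum>x\<in>ball x0 R \<inter> int_lattice. \<Sum>y\<in>ball x r \<inter> int_lattice. (f x - f y)\<^sup>2) \<le>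
      C * (1 + (3 * M) ^ d) * energy f {(y, z) \<in> links \<Gamma> R0 (ball x0 (R + M * r) \<inter> int_lattice). norm (y - z) < 2 * (M * r)}"
      unfolding A_def P_def .
  qed
qed

section \<open>Adding up the dyadic scales\<close>

text \<open>The term at the least admissible index is at most \<open>u powr (- s)\<close>, and each
  further doubling gains a factor at most 1/2 because \<open>s \<ge> 1\<close>. Hence the constant 2
  does not depend on \<open>s\<close>.\<close>

lemma geometric_powr_sum_le:
  fixes r0 u s :: real
  assumes I: "finite I" and r0: "0 < r0" and u: "0 < u" and s: "1 \<le> s"
  shows "(\<Sum>n\<in>{n\<in>I. u < r0 * 2 ^ n}. (r0 * 2 ^ n) powr (- s)) \<le> 2 * u powr (- s)"
proof -
  define J where "J = {n\<in>I. u < r0 * 2 ^ n}"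
  have finJ: "finite J" using I by (simp add: J_def)
  show ?thesis
  proof (cases "J = {}")
    case True
    then show ?thesis by (simp add: J_def[symmetric])
  next
    case False
    define k where "k = Min J"
    have k: "k \<in> J" "\<And>n. n \<in> J \<Longrightarrow> k \<le> n"
      using finJ False by (simp_all add: k_def)
    have "(r0 * 2 ^ n) powr (- s) \<le> u powr (- s) * (1 / 2) ^ (n - k)" if n: "n \<in> J" for n
    proof -
      have "r0 * 2 ^ n = (r0 * 2 ^ k) * 2 ^ (n - k)"
        using k(2)[OF n] by (simp add: power_add[symmetric])
      then have "(r0 * 2 ^ n) powr (- s) = (r0 * 2 ^ k) powr (- s) * (2 ^ (n - k)) powr (- s)"
        using r0 by (simp add: powr_mult)
      also have "\<dots> \<le> u powr (- s) * (2 ^ (n - k)) powr (- 1)"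
      proof (intro mult_mono)
        show "(r0 * 2 ^ k) powr (- s) \<le> u powr (- s)"
          using k(1) u s by (intro powr_mono2') (auto simp: J_def)
        show "((2::real) ^ (n - k)) powr (- s) \<le> (2 ^ (n - k)) powr (- 1)"
          using s by (intro powr_mono) auto
      qed auto
      also have "((2::real) ^ (n - k)) powr (- 1) = (1 / 2) ^ (n - k)"
        by (simp add: powr_minus power_one_over inverse_eq_divide)
      finally show ?thesis .
    qed
    then have "(\<Sum>n\<in>J. (r0 * 2 ^ n) powr (- s)) \<le> (\<Sum>n\<in>J. u powr (- s) * (1 / 2) ^ (n - k))"
      by (rule sum_mono)
    also have "\<dots> = u powr (- s) * (\<Sum>n\<in>J. (1 / 2) ^ (n - k))"
      by (simp add: sum_distrib_left)
    finally have sum_le: "(\<Sum>n\<in>J. (r0 * 2 ^ n) powr (- s)) \<le> u powr (- s) * (\<Sum>n\<in>J. (1 / 2) ^ (n - k))" .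
    have "(\<Sum>n\<in>J. (1 / 2 :: real) ^ (n - k)) = (\<Sum>m\<in>(\<lambda>n. n - k) ` J. (1 / 2) ^ m)"
    proof (rule sum.reindex_cong[symmetric])
      show "inj_on (\<lambda>n. n - k) J"
        using k(2) by (intro inj_onI) (metis le_add_diff_inverse)
    qed auto
    also have "\<dots> \<le> (\<Sum>m. (1 / 2 :: real) ^ m)"
      using finJ by (intro sum_le_suminf) (auto intro: summable_geometric)
    also have "\<dots> = 2" by (subst suminf_geometric) auto
    finally have "u powr (- s) * (\<Sum>n\<in>J. (1 / 2) ^ (n - k)) \<le> u powr (- s) * 2"
      by (rule mult_left_mono) simp
    with sum_le show ?thesis by (simp add: J_def mult.commute)
  qed
qed

lemma one_le_norm_lattice_diff:
  assumes "x \<in> int_lattice" "y \<in> int_lattice" "x \<noteq> y"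
  shows "1 \<le> norm (x - y)"
proof -
  obtain i where i: "x $ i \<noteq> y $ i" using assms by (auto simp: vec_eq_iff)
  have "(x - y) $ i \<in> \<int>" using assms by (auto simp: int_lattice_def)
  moreover have "(x - y) $ i \<noteq> 0" using i by simp
  ultimately have "1 \<le> \<bar>(x - y) $ i\<bar>" by (rule Ints_nonzero_abs_ge1)
  also have "\<dots> \<le> norm (x - y)" by (rule component_le_norm_cart)
  finally show ?thesis .
qed

text \<open>The least \<open>n\<close> with \<open>t < r0 * 2 ^ n\<close> works: either it is 0, or
  minimality bounds \<open>2 ^ (n - 1)\<close> by \<open>t\<close>. The first bound confines the
  scales to a finite range, the last one makes scale and length comparable.\<close>

lemma exists_dyadic_scale:
  fixes r0 t R :: real
  assumes r0: "1 \<le> r0" and t: "1 \<le> t" "t < 2 * R"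
  obtains n where "2 ^ n \<le> 4 * R" "t < r0 * 2 ^ n" "r0 * 2 ^ n \<le> 2 * r0 * t"
proof -
  obtain m where m: "t < 2 ^ m" using real_arch_pow[of 2 t] by auto
  define n where "n = (LEAST n. t < r0 * 2 ^ n)"
  have "2 ^ m \<le> r0 * 2 ^ m" using r0 by simp
  then have "t < r0 * 2 ^ m" using m by linarith
  then have n: "t < r0 * 2 ^ n" unfolding n_def by (rule LeastI)
  have "2 ^ n \<le> 2 * t"
  proof (cases n)
    case 0
    then show ?thesis using t by simp
  next
    case (Suc k)
    then have "\<not> t < r0 * 2 ^ k" unfolding n_def by (metis lessI not_less_Least)
    moreover have "2 ^ k \<le> r0 * 2 ^ k" using r0 by simp
    ultimately have "2 ^ k \<le> t" by linarith
    then show ?thesis using Suc by simp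
  qed
  moreover from this have "r0 * 2 ^ n \<le> r0 * (2 * t)" using r0 by (intro mult_left_mono) auto
  ultimately show thesis using n t by (intro that[of n]) auto
qed

text \<open>Each weight is dominated by a sum of \<open>\<rho> n powr (- s)\<close> over the scales
  exceeding the length. Exchanging sums allows the comparison at each scale separately; exchanging
  back leaves a geometric series for each link. The bound \<open>b\<close> on the exponent keeps the
  constants uniform in \<open>s\<close>.\<close>

lemma lattice_pairs_energy_bound:
  fixes \<epsilon> R0 b :: real
  assumes \<epsilon>: "0 < \<epsilon>" "\<epsilon> \<le> 1 / 4" and R0: "0 < R0"
  obtains c \<kappa> :: real where "c \<ge> 1" "\<kappa> \<ge> 1"
    "\<And>(\<Gamma> :: real ^ 'd \<Rightarrow> (real ^ 'd) set) s R x0 f. (\<And>x. contains_cone \<epsilon> (\<Gamma> x)) \<Longrightarrow>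
      1 \<le> s \<Longrightarrow> s \<le> b \<Longrightarrow>
      (\<Sum>(x, y)\<in>lattice_pairs R0 x0 R. (f x - f y)\<^sup>2 * norm (x - y) powr (- s)) \<le>
      c * (\<Sum>(x, y)\<in>links \<Gamma> R0 (ball x0 (\<kappa> * R) \<inter> int_lattice). (f x - f y)\<^sup>2 * norm (x - y) powr (- s))"
proof -
  obtain C M r0 :: real where C: "C \<ge> 1" and M: "M \<ge> 1" and r0: "r0 \<ge> 1"
    and bound: "\<And>(\<Gamma> :: real ^ 'd \<Rightarrow> (real ^ 'd) set) r x0 R f. (\<And>x. contains_cone \<epsilon> (\<Gamma> x)) \<Longrightarrow> r0 \<le> r \<Longrightarrow>
      (\<Sum>x\<in>ball x0 R \<inter> int_lattice. \<Sum>y\<in>ball x r \<inter> int_lattice. (f x - f y)\<^sup>2) \<le>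
      C * energy f {(y, z) \<in> links \<Gamma> R0 (ball x0 (R + M * r) \<inter> int_lattice). norm (y - z) < 2 * (M * r)}"
    by (rule single_scale_bound[OF \<epsilon> R0, where 'd = 'd]) blast
  \<comment> \<open>Scales do not exceed \<open>4 * r0 * R\<close>, so enlarging the ball by
    \<open>M\<close> times the scale stays within \<open>\<kappa> * R\<close>.\<close>
  define \<kappa> where "\<kappa> = 1 + M * (4 * r0)"
  \<comment> \<open>The factors come from replacing lengths by scales, from the comparison at one
    scale, and from the geometric series started at \<open>l e / (2 * M)\<close>.\<close>
  define c0 where "c0 = (2 * r0) powr b * C * (2 * (2 * M) powr b)"
  have Mr0: "0 \<le> M * (4 * r0)" using M r0 by simp
  show thesis
  proof (rule that)
    show "1 \<le> 1 + c0" using C by (simp add: c0_def)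
    show "1 \<le> \<kappa>" using Mr0 by (simp add: \<kappa>_def)
  next
    fix \<Gamma> :: "real ^ 'd \<Rightarrow> (real ^ 'd) set" and s R :: real
      and x0 :: "real ^ 'd" and f :: "real ^ 'd \<Rightarrow> real"
    assume \<Gamma>: "\<And>x. contains_cone \<epsilon> (\<Gamma> x)" and s: "1 \<le> s" "s \<le> b"
    define g where "g = (\<lambda>(x, y). (f x - f y)\<^sup>2)"
    define l where "l = (\<lambda>(x :: real ^ 'd, y). norm (x - y))"
    define P where "P = lattice_pairs R0 x0 R"
    define A where "A = ball x0 R \<inter> int_lattice"
    define L where "L = links \<Gamma> R0 (ball x0 (\<kappa> * R) \<inter> int_lattice)"
    define I where "I = {n :: nat. 2 ^ n \<le> 4 * R}"
    define \<rho> where "\<rho> n = r0 * 2 ^ n" for n :: nat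
    have g: "0 \<le> g e" for e by (simp add: g_def split: prod.split)
    have finP: "finite P" by (simp add: P_def finite_lattice_pairs)
    have finA: "finite A" by (simp add: A_def finite_lattice_ball)
    have finL: "finite L" by (simp add: L_def finite_links finite_lattice_ball)
    have finI: "finite I"
    proof -
      obtain m where m: "4 * R < 2 ^ m" using real_arch_pow[of 2 "4 * R"] by auto
      have "n < m" if "n \<in> I" for n
      proof (rule ccontr)
        assume "\<not> n < m"
        then have "(2::real) ^ m \<le> 2 ^ n" by (intro power_increasing) auto
        also have "\<dots> \<le> 4 * R" using that by (simp add: I_def)
        finally show False using m by simp
      qed
      then have "I \<subseteq> {..<m}" by auto
      then show ?thesis by (rule finite_subset) simp
    qed
    have \<rho>: "r0 \<le> \<rho> n" "0 < \<rho> n" for n using r0 by (simp_all add: \<rho>_def)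
    have lL: "0 < l e" if "e \<in> L" for e
      using that R0 by (auto simp: L_def l_def links_def)

    \<comment> \<open>short pairs are compared at scale \<open>r0\<close>, which costs only a constant as lattice distances are at least 1\<close>
    have pair: "l e powr (- s) \<le> (2 * r0) powr b * (\<Sum>n\<in>{n\<in>I. l e < \<rho> n}. \<rho> n powr (- s))"
      if e: "e \<in> P" for e
    proof -
      obtain x y where xy: "e = (x, y)" "x \<in> A" "y \<in> A" "R0 < norm (x - y)"
        using e by (auto simp: P_def A_def lattice_pairs_def)
      have "x \<noteq> y" using xy R0 by auto
      then have l1: "1 \<le> l e"
        using xy by (auto simp: l_def A_def intro!: one_le_norm_lattice_diff)
      have "dist x0 x < R" "dist x0 y < R" using xy by (auto simp: A_def)
      then have l2: "l e < 2 * R"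
        using dist_triangle3[of x y x0] xy by (simp add: l_def dist_norm)
      obtain n where n: "2 ^ n \<le> 4 * R" "l e < r0 * 2 ^ n" "r0 * 2 ^ n \<le> 2 * r0 * l e"
        by (rule exists_dyadic_scale[OF r0 l1 l2])
      have "l e powr (- s) = (2 * r0) powr s * (2 * r0 * l e) powr (- s)"
        using r0 l1 by (simp add: powr_mult powr_minus field_simps)
      also have "\<dots> \<le> (2 * r0) powr b * \<rho> n powr (- s)"
      proof (intro mult_mono)
        show "(2 * r0) powr s \<le> (2 * r0) powr b" using s r0 by (intro powr_mono) auto
        show "(2 * r0 * l e) powr (- s) \<le> \<rho> n powr (- s)"
          using n(3) \<rho>(2)[of n] s by (intro powr_mono2') (auto simp: \<rho>_def)
      qed auto
      \<comment> \<open>The chosen scale is one term of a sum of nonnegative terms.\<close>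
      also have "\<dots> \<le> (2 * r0) powr b * (\<Sum>n\<in>{n\<in>I. l e < \<rho> n}. \<rho> n powr (- s))"
        using n finI by (intro mult_left_mono member_le_sum) (auto simp: I_def \<rho>_def)
      finally show ?thesis .
    qed

    have scale: "(\<Sum>e\<in>{e\<in>P. l e < \<rho> n}. g e) \<le> C * (\<Sum>e\<in>{e\<in>L. l e / (2 * M) < \<rho> n}. g e)"
      if n: "n \<in> I" for n
    proof -
      have fin: "finite (ball x (\<rho> n) \<inter> int_lattice)" for x :: "real ^ 'd"
        by (rule finite_lattice_ball)
      have "(\<Sum>e\<in>{e\<in>P. l e < \<rho> n}. g e) \<le> (\<Sum>e\<in>Sigma A (\<lambda>x. ball x (\<rho> n) \<inter> int_lattice). g e)"
        using finA fin g
        by (intro sum_mono2) (auto simp: P_def A_def l_def lattice_pairs_def dist_norm)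
      also have "\<dots> = (\<Sum>x\<in>A. \<Sum>y\<in>ball x (\<rho> n) \<inter> int_lattice. (f x - f y)\<^sup>2)"
        unfolding g_def using finA fin by (intro sum.Sigma[symmetric]) auto
      also have "\<dots> \<le> C * energy f {(y, z) \<in> links \<Gamma> R0 (ball x0 (R + M * \<rho> n) \<inter> int_lattice).
          norm (y - z) < 2 * (M * \<rho> n)}"
        unfolding A_def by (rule bound[OF \<Gamma> \<rho>(1)])
      also have "\<dots> \<le> C * energy f {e\<in>L. l e / (2 * M) < \<rho> n}"
      proof (intro mult_left_mono energy_mono)
        have "r0 * 2 ^ n \<le> r0 * (4 * R)" using n r0 by (intro mult_left_mono) (auto simp: I_def)
        then have "M * \<rho> n \<le> M * (r0 * (4 * R))" using M by (intro mult_left_mono) (auto simp: \<rho>_def)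
        then have "R + M * \<rho> n \<le> \<kappa> * R" by (simp add: \<kappa>_def algebra_simps)
        then have "links \<Gamma> R0 (ball x0 (R + M * \<rho> n) \<inter> int_lattice) \<subseteq> L"
          unfolding L_def by (intro links_mono Int_mono subset_ball order_refl)
        then show "{(y, z) \<in> links \<Gamma> R0 (ball x0 (R + M * \<rho> n) \<inter> int_lattice).
          norm (y - z) < 2 * (M * \<rho> n)} \<subseteq> {e\<in>L. l e / (2 * M) < \<rho> n}"
          using M by (auto simp: l_def divide_less_eq mult_ac)
      qed (use finL C in auto)
      finally show ?thesis by (simp add: energy_def g_def)
    qed

    have "(\<Sum>e\<in>P. g e * l e powr (- s)) \<le>
        (\<Sum>e\<in>P. g e * ((2 * r0) powr b * (\<Sum>n\<in>{n\<in>I. l e < \<rho> n}. \<rho> n powr (- s))))"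
      by (intro sum_mono mult_left_mono pair g)
    also have "\<dots> = (2 * r0) powr b * (\<Sum>e\<in>P. \<Sum>n\<in>{n\<in>I. l e < \<rho> n}. g e * \<rho> n powr (- s))"
      by (simp add: sum_distrib_left mult_ac)
    also have "\<dots> = (2 * r0) powr b * (\<Sum>n\<in>I. \<Sum>e\<in>{e\<in>P. l e < \<rho> n}. g e * \<rho> n powr (- s))"
      by (simp only: sum.swap_restrict[OF finP finI])
    also have "\<dots> \<le> (2 * r0) powr b * (\<Sum>n\<in>I. C * (\<Sum>e\<in>{e\<in>L. l e / (2 * M) < \<rho> n}. g e * \<rho> n powr (- s)))"
    proof (intro mult_left_mono sum_mono)
      fix n assume "n \<in> I"
      from mult_right_mono[OF scale[OF this], of "\<rho> n powr (- s)"]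
      show "(\<Sum>e\<in>{e\<in>P. l e < \<rho> n}. g e * \<rho> n powr (- s)) \<le>
          C * (\<Sum>e\<in>{e\<in>L. l e / (2 * M) < \<rho> n}. g e * \<rho> n powr (- s))"
        by (simp add: sum_distrib_right mult.assoc)
    qed simp
    also have "\<dots> = (2 * r0) powr b * C * (\<Sum>n\<in>I. \<Sum>e\<in>{e\<in>L. l e / (2 * M) < \<rho> n}. g e * \<rho> n powr (- s))"
      by (simp add: sum_distrib_left[symmetric])
    also have "\<dots> = (2 * r0) powr b * C * (\<Sum>e\<in>L. \<Sum>n\<in>{n\<in>I. l e / (2 * M) < \<rho> n}. g e * \<rho> n powr (- s))"
      by (simp only: sum.swap_restrict[OF finI finL])
    also have "\<dots> \<le> (2 * r0) powr b * C * (\<Sum>e\<in>L. 2 * (2 * M) powr b * (g e * l e powr (- s)))"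
    proof (intro mult_left_mono sum_mono)
      fix e assume e: "e \<in> L"
      \<comment> \<open>A link occurs only at scales above its length divided by
        \<open>2 * M\<close>, so its total weight is a geometric tail comparable to
        \<open>l e powr (- s)\<close>.\<close>
      have "(\<Sum>n\<in>{n\<in>I. l e / (2 * M) < \<rho> n}. \<rho> n powr (- s)) \<le> 2 * (l e / (2 * M)) powr (- s)"
        unfolding \<rho>_def using lL[OF e] M r0 s by (intro geometric_powr_sum_le finI) auto
      also have "\<dots> = 2 * (2 * M) powr s * l e powr (- s)"
        using lL[OF e] M by (simp add: powr_divide powr_minus field_simps)
      also have "\<dots> \<le> 2 * (2 * M) powr b * l e powr (- s)"
        using s M by (intro mult_right_mono mult_left_mono powr_mono) auto
      finally have "g e * (\<Sum>n\<in>{n\<in>I. l e / (2 * M) < \<rho> n}. \<rho> n powr (- s)) \<le>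
          g e * (2 * (2 * M) powr b * l e powr (- s))"
        by (rule mult_left_mono[OF _ g])
      then show "(\<Sum>n\<in>{n\<in>I. l e / (2 * M) < \<rho> n}. g e * \<rho> n powr (- s)) \<le>
          2 * (2 * M) powr b * (g e * l e powr (- s))"
        by (simp add: sum_distrib_left mult_ac)
    qed (use C in auto)
    also have "\<dots> = c0 * (\<Sum>e\<in>L. g e * l e powr (- s))"
      by (simp add: c0_def sum_distrib_left[symmetric])
    also have "\<dots> \<le> (1 + c0) * (\<Sum>e\<in>L. g e * l e powr (- s))"
      using g by (intro mult_right_mono sum_nonneg mult_nonneg_nonneg) auto
    finally show "(\<Sum>(x, y)\<in>lattice_pairs R0 x0 R. (f x - f y)\<^sup>2 * norm (x - y) powr (- s)) \<le>
      (1 + c0) * (\<Sum>(x, y)\<in>links \<Gamma> R0 (ball x0 (\<kappa> * R) \<inter> int_lattice). (f x - f y)\<^sup>2 * norm (x - y) powr (- s))"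
      by (simp add: P_def L_def g_def l_def case_prod_beta)
  qed
qed

section \<open>Passage from links to the kernel\<close>

text \<open>On a link the weight is at most \<open>\<Lambda>\<close> times the kernel, and links in
  the enlarged ball are among its lattice pairs. The constants are fixed before
  \<open>\<Gamma>\<close>, \<open>\<alpha>\<close> and \<open>\<omega>\<close> are introduced, which
  gives the required independence.\<close>

theorem theorem1p3:
  fixes \<theta> R0 \<Lambda> :: real
  assumes "R0 > 0" and "\<Lambda> \<ge> 1"
  shows "\<exists>c\<ge>1. \<forall>(\<Gamma> :: real ^ 'd \<Rightarrow> (real ^ 'd) set) (\<alpha> :: real)
            (\<omega> :: real ^ 'd \<Rightarrow> real ^ 'd \<Rightarrow> ennreal).
      bounded_configuration \<theta> \<Gamma> \<longrightarrow> 0 < \<alpha> \<longrightarrow> \<alpha> < 2 \<longrightarrow>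
      (\<forall>x\<in>int_lattice. \<forall>y\<in>int_lattice. \<omega> x y = \<omega> y x) \<longrightarrow>
      (\<forall>x\<in>int_lattice. \<forall>y\<in>int_lattice. norm (x - y) > R0 \<longrightarrow>
         ennreal (inverse \<Lambda> * (indicator (cone_at \<Gamma> x) y + indicator (cone_at \<Gamma> y) x)
                  * norm (x - y) powr (- real CARD('d) - \<alpha>)) \<le> \<omega> x y \<and>
         \<omega> x y \<le> ennreal (\<Lambda> * norm (x - y) powr (- real CARD('d) - \<alpha>))) \<longrightarrow>
      (\<exists>\<kappa>\<ge>1. \<forall>R>0. \<forall>(x0 :: real ^ 'd) (f :: real ^ 'd \<Rightarrow> real).
         (\<Sum>(x, y)\<in>lattice_pairs R0 x0 R.
            ennreal ((f x - f y)\<^sup>2 * norm (x - y) powr (- real CARD('d) - \<alpha>)))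
         \<le> ennreal c * (\<Sum>(x, y)\<in>lattice_pairs R0 x0 (\<kappa> * R). ennreal ((f x - f y)\<^sup>2) * \<omega> x y))"
proof (cases "0 < \<theta> \<and> \<theta> \<le> pi / 2")
  case False
  \<comment> \<open>Outside this range no configuration has the bound \<open>\<theta>\<close>, and
    any constant will do.\<close>
  then have "\<not> bounded_configuration \<theta> \<Gamma>" for \<Gamma> :: "real ^ 'd \<Rightarrow> (real ^ 'd) set"
    using bounded_configuration_contains_cone(1,2) by blast
  then show ?thesis by (intro exI[of _ 1]) simp
next
  case True
  define \<epsilon> where "\<epsilon> = (1 - cos \<theta>) / 4"
  have "0 \<le> cos \<theta>" using True by (intro cos_ge_zero) auto
  moreover have "cos \<theta> < 1" using cos_monotone_0_pi[of 0 \<theta>] True pi_gt_zero by simp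
  ultimately have \<epsilon>: "0 < \<epsilon>" "\<epsilon> \<le> 1 / 4" by (simp_all add: \<epsilon>_def)
  \<comment> \<open>The exponent \<open>s = CARD('d) + \<alpha>\<close> stays between 1 and
    \<open>CARD('d) + 2\<close>, so one choice serves all \<open>\<alpha>\<close>.\<close>
  obtain c \<kappa> :: real where c: "c \<ge> 1" and \<kappa>: "\<kappa> \<ge> 1"
    and bound: "\<And>(\<Gamma> :: real ^ 'd \<Rightarrow> (real ^ 'd) set) s R x0 f. (\<And>x. contains_cone \<epsilon> (\<Gamma> x)) \<Longrightarrow>
      1 \<le> s \<Longrightarrow> s \<le> real CARD('d) + 2 \<Longrightarrow>
      (\<Sum>(x, y)\<in>lattice_pairs R0 x0 R. (f x - f y)\<^sup>2 * norm (x - y) powr (- s)) \<le>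
      c * (\<Sum>(x, y)\<in>links \<Gamma> R0 (ball x0 (\<kappa> * R) \<inter> int_lattice). (f x - f y)\<^sup>2 * norm (x - y) powr (- s))"
    by (rule lattice_pairs_energy_bound[OF \<epsilon> assms(1), where 'd = 'd]) blast
  have \<Lambda>: "0 < \<Lambda>" using assms by simp
  show ?thesis
  proof (rule exI[of _ "c * \<Lambda>"], intro conjI allI impI)
    show "1 \<le> c * \<Lambda>" using mult_mono[of 1 c 1 \<Lambda>] c assms by simp
  next
    fix \<Gamma> :: "real ^ 'd \<Rightarrow> (real ^ 'd) set" and \<alpha> :: real
      and \<omega> :: "real ^ 'd \<Rightarrow> real ^ 'd \<Rightarrow> ennreal"
    assume \<Gamma>: "bounded_configuration \<theta> \<Gamma>" and \<alpha>: "0 < \<alpha>" "\<alpha> < 2"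
    assume \<omega>: "\<forall>x\<in>int_lattice. \<forall>y\<in>int_lattice. norm (x - y) > R0 \<longrightarrow>
         ennreal (inverse \<Lambda> * (indicator (cone_at \<Gamma> x) y + indicator (cone_at \<Gamma> y) x)
                  * norm (x - y) powr (- real CARD('d) - \<alpha>)) \<le> \<omega> x y \<and>
         \<omega> x y \<le> ennreal (\<Lambda> * norm (x - y) powr (- real CARD('d) - \<alpha>))"
    define s where "s = real CARD('d) + \<alpha>"
    have s_eq: "- real CARD('d) - \<alpha> = - s" by (simp add: s_def)
    have "1 \<le> real CARD('d)" by (simp add: Suc_leI)
    then have "1 + 0 \<le> s" unfolding s_def using \<alpha> by (intro add_mono) auto
    then have s: "1 \<le> s" "s \<le> real CARD('d) + 2" using \<alpha> by (auto simp: s_def)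
    have cone: "contains_cone \<epsilon> (\<Gamma> x)" for x
      unfolding \<epsilon>_def by (rule bounded_configuration_contains_cone(3)[OF \<Gamma>])
    show "\<exists>\<kappa>\<ge>1. \<forall>R>0. \<forall>(x0 :: real ^ 'd) (f :: real ^ 'd \<Rightarrow> real).
         (\<Sum>(x, y)\<in>lattice_pairs R0 x0 R.
            ennreal ((f x - f y)\<^sup>2 * norm (x - y) powr (- real CARD('d) - \<alpha>)))
         \<le> ennreal (c * \<Lambda>) * (\<Sum>(x, y)\<in>lattice_pairs R0 x0 (\<kappa> * R). ennreal ((f x - f y)\<^sup>2) * \<omega> x y)"
      unfolding s_eq
    proof (rule exI[of _ \<kappa>], intro conjI allI impI \<kappa>)
      fix R :: real and x0 :: "real ^ 'd" and f :: "real ^ 'd \<Rightarrow> real"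
      define L where "L = links \<Gamma> R0 (ball x0 (\<kappa> * R) \<inter> int_lattice)"
      let ?w = "\<lambda>(x, y). (f x - f y)\<^sup>2 * norm (x - y) powr (- s)"
      let ?v = "\<lambda>(x, y). ennreal ((f x - f y)\<^sup>2) * \<omega> x y"
      have nn: "0 \<le> ?w e" for e by (cases e) simp
      have sub: "L \<subseteq> lattice_pairs R0 x0 (\<kappa> * R)"
        by (auto simp: L_def links_def lattice_pairs_def)
      \<comment> \<open>The indicator of the cone at the first endpoint is 1 on a link and the other
        is nonnegative, so their sum is at least 1.\<close>
      have w: "ennreal (?w e) \<le> ennreal \<Lambda> * ?v e" if eL: "e \<in> L" for e
      proof -
        obtain x y where e: "e = (x, y)" "x \<in> int_lattice" "y \<in> int_lattice"
          "R0 < norm (x - y)" "y \<in> cone_at \<Gamma> x"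
          using eL by (auto simp: L_def links_def)
        let ?j = "indicator (cone_at \<Gamma> x) y + indicator (cone_at \<Gamma> y) x :: real"
        have "norm (x - y) powr (- s) = \<Lambda> * (inverse \<Lambda> * 1 * norm (x - y) powr (- s))"
          using \<Lambda> by simp
        also have "\<dots> \<le> \<Lambda> * (inverse \<Lambda> * ?j * norm (x - y) powr (- s))"
          using \<Lambda> e by (intro mult_left_mono mult_right_mono) auto
        finally have "ennreal (norm (x - y) powr (- s)) \<le>
            ennreal \<Lambda> * ennreal (inverse \<Lambda> * ?j * norm (x - y) powr (- s))"
          using \<Lambda> by (subst ennreal_mult[symmetric]) (auto intro: ennreal_leI)
        also have "\<dots> \<le> ennreal \<Lambda> * \<omega> x y"
          using \<omega>[rule_format, OF e(2-4)] unfolding s_eq by (intro mult_left_mono) simp_all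
        finally have "ennreal ((f x - f y)\<^sup>2) * ennreal (norm (x - y) powr (- s)) \<le>
            ennreal ((f x - f y)\<^sup>2) * (ennreal \<Lambda> * \<omega> x y)"
          by (rule mult_left_mono) simp
        then show ?thesis using e by (simp add: ennreal_mult mult_ac)
      qed
      have "(\<Sum>(x, y)\<in>lattice_pairs R0 x0 R. ennreal ((f x - f y)\<^sup>2 * norm (x - y) powr (- s))) =
          ennreal (\<Sum>e\<in>lattice_pairs R0 x0 R. ?w e)"
        by (subst sum_ennreal[symmetric]) (auto simp: case_prod_beta)
      \<comment> \<open>The comparison with links takes place between real sums; the kernel enters
        only afterwards, term by term.\<close>
      also have "\<dots> \<le> ennreal (c * (\<Sum>e\<in>L. ?w e))"
        unfolding L_def by (intro ennreal_leI bound cone s)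
      also have "\<dots> = ennreal c * (\<Sum>e\<in>L. ennreal (?w e))"
        using c nn by (simp add: ennreal_mult sum_nonneg sum_ennreal)
      also have "\<dots> \<le> ennreal c * (\<Sum>e\<in>L. ennreal \<Lambda> * ?v e)"
        by (intro mult_left_mono sum_mono w) auto
      also have "\<dots> = ennreal (c * \<Lambda>) * (\<Sum>e\<in>L. ?v e)"
        using c \<Lambda> by (simp add: ennreal_mult sum_distrib_left[symmetric] mult.assoc)
      also have "\<dots> \<le> ennreal (c * \<Lambda>) * (\<Sum>e\<in>lattice_pairs R0 x0 (\<kappa> * R). ?v e)"
        using sub by (intro mult_left_mono sum_mono2 finite_lattice_pairs) auto
      finally show "(\<Sum>(x, y)\<in>lattice_pairs R0 x0 R. ennreal ((f x - f y)\<^sup>2 * norm (x - y) powr (- s))) \<le>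
          ennreal (c * \<Lambda>) * (\<Sum>(x, y)\<in>lattice_pairs R0 x0 (\<kappa> * R). ennreal ((f x - f y)\<^sup>2) * \<omega> x y)" .
    qed
  qed
qed

end
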